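(* Let $(b,0)$ be a graph over the discrete measure space $(X,m)$ and let $L_0$ be a realization associated with a form $(Q_0,D(Q_0))$ over $(b,0)$ such that $D(Q_0)$, equipped with the form norm $\|\cdot\|_{Q_0}$, is compactly embedded in $\ell^2(X,m)$. Let $c\colon X\to[0,\infty)$ and let $L_c$ be the induced realization. Assume $\frac cm\in\ell^1(X,\mathbf 1)$. If $\lambda_n(c)=\lambda_n(0)$ for all $n=1,\dots,\dim\ell^2(X,m)$, where $\lambda_n(0)$ and $\lambda_n(c)$ denote the $n$-th eigenvalues of $L_0$ and $L_c$, then $c=0$.
   Context: Let $X$ be a non-empty, at most countable set, $b\colon X\times X\to[0,\infty)$ symmetric with $b(x,x)=0$ and $\sum_{y\in X}b(x,y)<\infty$ for all $x\in X$, and let $c\colon X\to[0,\infty)$ and $m\colon X\to(0,\infty)$ be maps; $m$ is extended to a measure on $X$ by $m(A)=\sum_{x\in A}m(x)$. Then $(b,c)$ is called a graph over the discrete measure space $(X,m)$. Let $C(X)$ be the space of real functions on $X$, $C_c(X)$ the subspace of finitely supported functions, and let $\ell^2(X,m)=\{f\in C(X):\sum_{x\in X}|f(x)|^2m(x)<\infty\}$ be the Hilbert space with scalar product $\langle f,g\rangle=\sum_{x\in X}f(x)g(x)m(x)$. $\ell^1(X,\mathbf 1)$ denotes absolutely summable functions with respect to counting measure. Set $\mathcal D_{b,c}=\{f\in C(X):\sum_{x,y\in X}b(x,y)|f(x)-f(y)|^2+\sum_{x\in X}c(x)|f(x)|^2<\infty\}$ and, for $f,g\in\mathcal D_{b,c}$,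 $$\mathcal Q_{b,c}(f,g)=\tfrac12\sum_{x,y\in X}b(x,y)(f(x)-f(y))(g(x)-g(y))+\sum_{x\in X}c(x)f(x)g(x).$$ Realization: let $Q_0$ be the restriction of $\mathcal Q_{b,0}$ to a linear subspace $D(Q_0)\subset \ell^2(X,m)\cap\mathcal D_{b,0}$ with $C_c(X)\subset D(Q_0)$ such that $Q_0$ is closed, i.e. $D(Q_0)$ is complete with respect to the form norm $\|f\|_{Q_0}^2=\|f\|_{\ell^2(X,m)}^2+Q_0(f,f)$. The positive self-adjoint operator $L_0$ in $\ell^2(X,m)$ associated with $Q_0$ via the form representation theorem ($D(L_0)\subset D(Q_0)$ and $Q_0(f,g)=\langle f,L_0g\rangle$ for $f\in D(Q_0)$, $g\in D(L_0)$) is called a realization. Induced realization: given a realization $L_0$ and $c\colon X\to[0,\infty)$, let $Q_c$ be the restriction of $\mathcal Q_{b,c}$ to $$D(Q_c)=D(Q_0)\cap\Big\{f\in\ell^2(X,m):\sum_{x\in X}c(x)|f(x)|^2<\infty\Big\}.$$ The self-adjoint operator $L_c$ in $\ell^2(X,m)$ associated with $Q_c$ is called the induced realization of $c$. Under the compact embedding hypothesis on $D(Q_0)$, both $L_0$ and $L_c$ have purely discrete spectrum; their eigenvalues $\lambda_n(0)$, $\lambda_n(c)$, $n=1,\dots,\dim\ell^2(X,m)$, are listed in non-decreasing order, counted with multiplicity. If $X$ is infinite, $\dim\ell^2(X,m)=\infty$ and $n$ ranges over all positive integers. *)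

theory Defs
  imports "HOL-Analysis.Analysis" "HOL-Library.Function_Algebras"
begin

section \<open>The vector space of real functions\<close>

definition fun_scale :: "real \<Rightarrow> ('a \<Rightarrow> real) \<Rightarrow> 'a \<Rightarrow> real" where
  "fun_scale r f = (\<lambda>x. r * f x)"

global_interpretation fun_space: vector_space "fun_scale :: real \<Rightarrow> ('a \<Rightarrow> real) \<Rightarrow> 'a \<Rightarrow> real"
  by unfold_locales (auto simp: fun_scale_def plus_fun_def algebra_simps)

definition fin_supp_funs :: "('a \<Rightarrow> real) set" where
  "fin_supp_funs = {f. finite {x. f x \<noteq> 0}}"


section \<open>Graphs over discrete measure spaces\<close>

definition graph_over :: "('a \<Rightarrow> 'a \<Rightarrow> real) \<Rightarrow> ('a \<Rightarrow> real) \<Rightarrow> ('a \<Rightarrow> real) \<Rightarrow> bool" where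
  "graph_over b c m \<longleftrightarrow>
     (\<forall>x y. 0 \<le> b x y) \<and> (\<forall>x y. b x y = b y x) \<and> (\<forall>x. b x x = 0) \<and>
     (\<forall>x. (\<lambda>y. b x y) summable_on UNIV) \<and>
     (\<forall>x. 0 \<le> c x) \<and> (\<forall>x. 0 < m x)"

definition ell2 :: "('a \<Rightarrow> real) \<Rightarrow> ('a \<Rightarrow> real) set" where
  "ell2 m = {f. (\<lambda>x. \<bar>f x\<bar>\<^sup>2 * m x) summable_on UNIV}"

definition ell2_inner :: "('a \<Rightarrow> real) \<Rightarrow> ('a \<Rightarrow> real) \<Rightarrow> ('a \<Rightarrow> real) \<Rightarrow> real" where
  "ell2_inner m f g = (\<Sum>\<^sub>\<infinity>x. f x * g x * m x)"

definition ell2_norm :: "('a \<Rightarrow> real) \<Rightarrow> ('a \<Rightarrow> real) \<Rightarrow> real" where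
  "ell2_norm m f = sqrt (ell2_inner m f f)"

definition ell2_topology :: "('a \<Rightarrow> real) \<Rightarrow> ('a \<Rightarrow> real) topology" where
  "ell2_topology m = Metric_space.mtopology (ell2 m) (\<lambda>f g. ell2_norm m (f - g))"

definition energy_space :: "('a \<Rightarrow> 'a \<Rightarrow> real) \<Rightarrow> ('a \<Rightarrow> real) \<Rightarrow> ('a \<Rightarrow> real) set" where
  "energy_space b c =
     {f. (\<lambda>(x, y). b x y * \<bar>f x - f y\<bar>\<^sup>2) summable_on UNIV \<and>
         (\<lambda>x. c x * \<bar>f x\<bar>\<^sup>2) summable_on UNIV}"

definition energy_form ::
    "('a \<Rightarrow> 'a \<Rightarrow> real) \<Rightarrow> ('a \<Rightarrow> real) \<Rightarrow> ('a \<Rightarrow> real) \<Rightarrow> ('a \<Rightarrow> real) \<Rightarrow> real" where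
  "energy_form b c f g =
     1 / 2 * (\<Sum>\<^sub>\<infinity>(x, y). b x y * (f x - f y) * (g x - g y)) + (\<Sum>\<^sub>\<infinity>x. c x * f x * g x)"


section \<open>Closed forms and associated operators\<close>

text \<open>A form is given by a function \<open>Q\<close> together with its domain \<open>D\<close>, and an
  unbounded operator by a function \<open>L\<close> together with its domain \<open>DL\<close>; only the values
  on the domains are relevant.\<close>

definition form_norm ::
    "('a \<Rightarrow> real) \<Rightarrow> (('a \<Rightarrow> real) \<Rightarrow> ('a \<Rightarrow> real) \<Rightarrow> real) \<Rightarrow> ('a \<Rightarrow> real) \<Rightarrow> real" where
  "form_norm m Q f = sqrt ((ell2_norm m f)\<^sup>2 + Q f f)"

definition closed_form ::
    "('a \<Rightarrow> real) \<Rightarrow> (('a \<Rightarrow> real) \<Rightarrow> ('a \<Rightarrow> real) \<Rightarrow> real) \<Rightarrow> ('a \<Rightarrow> real) set \<Rightarrow> bool" where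
  "closed_form m Q D \<longleftrightarrow> Metric_space.mcomplete D (\<lambda>f g. form_norm m Q (f - g))"

text \<open>Compactness of the inclusion map: the image of the unit ball of \<open>D\<close> is relatively
  compact.\<close>

definition compactly_embedded ::
    "('a \<Rightarrow> real) \<Rightarrow> (('a \<Rightarrow> real) \<Rightarrow> ('a \<Rightarrow> real) \<Rightarrow> real) \<Rightarrow> ('a \<Rightarrow> real) set \<Rightarrow> bool" where
  "compactly_embedded m Q D \<longleftrightarrow>
     compactin (ell2_topology m) (ell2_topology m closure_of {f \<in> D. form_norm m Q f \<le> 1})"

definition linear_operator ::
    "('a \<Rightarrow> real) set \<Rightarrow> (('a \<Rightarrow> real) \<Rightarrow> 'a \<Rightarrow> real) \<Rightarrow> bool" where
  "linear_operator DL L \<longleftrightarrow>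
     fun_space.subspace DL \<and>
     (\<forall>f\<in>DL. \<forall>g\<in>DL. L (f + g) = L f + L g) \<and>
     (\<forall>r. \<forall>f\<in>DL. L (fun_scale r f) = fun_scale r (L f))"

definition adjoint_graph ::
    "('a \<Rightarrow> real) \<Rightarrow> ('a \<Rightarrow> real) set \<Rightarrow> (('a \<Rightarrow> real) \<Rightarrow> 'a \<Rightarrow> real) \<Rightarrow>
     (('a \<Rightarrow> real) \<times> ('a \<Rightarrow> real)) set" where
  "adjoint_graph m DL L =
     {(g, h). g \<in> ell2 m \<and> h \<in> ell2 m \<and> (\<forall>f\<in>DL. ell2_inner m (L f) g = ell2_inner m f h)}"

definition self_adjoint ::
    "('a \<Rightarrow> real) \<Rightarrow> ('a \<Rightarrow> real) set \<Rightarrow> (('a \<Rightarrow> real) \<Rightarrow> 'a \<Rightarrow> real) \<Rightarrow> bool" where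
  "self_adjoint m DL L \<longleftrightarrow>
     linear_operator DL L \<and> DL \<subseteq> ell2 m \<and> L ` DL \<subseteq> ell2 m \<and>
     ell2_topology m closure_of DL = ell2 m \<and>
     adjoint_graph m DL L = {(g, L g) | g. g \<in> DL}"

definition associated_operator ::
    "('a \<Rightarrow> real) \<Rightarrow> (('a \<Rightarrow> real) \<Rightarrow> ('a \<Rightarrow> real) \<Rightarrow> real) \<Rightarrow> ('a \<Rightarrow> real) set \<Rightarrow>
     ('a \<Rightarrow> real) set \<Rightarrow> (('a \<Rightarrow> real) \<Rightarrow> 'a \<Rightarrow> real) \<Rightarrow> bool" where
  "associated_operator m Q D DL L \<longleftrightarrow>
     self_adjoint m DL L \<and> (\<forall>f\<in>DL. 0 \<le> ell2_inner m f (L f)) \<and>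
     DL \<subseteq> D \<and> (\<forall>f\<in>D. \<forall>g\<in>DL. Q f g = ell2_inner m f (L g))"


section \<open>Realizations\<close>

definition realization_form ::
    "('a \<Rightarrow> 'a \<Rightarrow> real) \<Rightarrow> ('a \<Rightarrow> real) \<Rightarrow> ('a \<Rightarrow> real) set \<Rightarrow> bool" where
  "realization_form b m D \<longleftrightarrow>
     fun_space.subspace D \<and> D \<subseteq> ell2 m \<inter> energy_space b (\<lambda>_. 0) \<and> fin_supp_funs \<subseteq> D \<and>
     closed_form m (energy_form b (\<lambda>_. 0)) D"

definition realization ::
    "('a \<Rightarrow> 'a \<Rightarrow> real) \<Rightarrow> ('a \<Rightarrow> real) \<Rightarrow> ('a \<Rightarrow> real) set \<Rightarrow>
     ('a \<Rightarrow> real) set \<Rightarrow> (('a \<Rightarrow> real) \<Rightarrow> 'a \<Rightarrow> real) \<Rightarrow> bool" where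
  "realization b m D DL L \<longleftrightarrow>
     realization_form b m D \<and> associated_operator m (energy_form b (\<lambda>_. 0)) D DL L"

definition induced_domain ::
    "('a \<Rightarrow> real) \<Rightarrow> ('a \<Rightarrow> real) \<Rightarrow> ('a \<Rightarrow> real) set \<Rightarrow> ('a \<Rightarrow> real) set" where
  "induced_domain c m D = D \<inter> {f \<in> ell2 m. (\<lambda>x. c x * \<bar>f x\<bar>\<^sup>2) summable_on UNIV}"

definition induced_realization ::
    "('a \<Rightarrow> 'a \<Rightarrow> real) \<Rightarrow> ('a \<Rightarrow> real) \<Rightarrow> ('a \<Rightarrow> real) \<Rightarrow> ('a \<Rightarrow> real) set \<Rightarrow>
     ('a \<Rightarrow> real) set \<Rightarrow> (('a \<Rightarrow> real) \<Rightarrow> 'a \<Rightarrow> real) \<Rightarrow> bool" where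
  "induced_realization b c m D DL L \<longleftrightarrow>
     associated_operator m (energy_form b c) (induced_domain c m D) DL L"


section \<open>Eigenvalues counted with multiplicity\<close>

definition eigenspace ::
    "('a \<Rightarrow> real) set \<Rightarrow> (('a \<Rightarrow> real) \<Rightarrow> 'a \<Rightarrow> real) \<Rightarrow> real \<Rightarrow> ('a \<Rightarrow> real) set" where
  "eigenspace DL L t = {f \<in> DL. L f = fun_scale t f}"

text \<open>The indices \<open>n = 1, \<dots>, dim \<ell>\<^sup>2(X, m)\<close>, including the case of infinite dimension.\<close>

definition eigen_indices :: "('a \<Rightarrow> real) \<Rightarrow> nat set" where
  "eigen_indices m =
     {n. 1 \<le> n \<and>
         (\<exists>B. B \<subseteq> ell2 m \<and> fun_space.independent B \<and> finite B \<and> card B = n)}"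

text \<open>A non-decreasing enumeration in which each real \<open>t\<close> occurs as often as the
  dimension of the eigenspace for \<open>t\<close>, that is, not at all if \<open>t\<close> is not an eigenvalue.\<close>

definition eigenvalue_listing ::
    "('a \<Rightarrow> real) \<Rightarrow> ('a \<Rightarrow> real) set \<Rightarrow> (('a \<Rightarrow> real) \<Rightarrow> 'a \<Rightarrow> real) \<Rightarrow>
     (nat \<Rightarrow> real) \<Rightarrow> bool" where
  "eigenvalue_listing m DL L lam \<longleftrightarrow>
     mono_on (eigen_indices m) lam \<and>
     (\<forall>t. \<exists>B h. fun_space.independent B \<and> fun_space.span B = eigenspace DL L t \<and>
                bij_betw h {n \<in> eigen_indices m. lam n = t} B)"

text \<open>For operators with compact resolvent a listing exists and its values on
  \<open>eigen_indices m\<close> are uniquely determined.\<close>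

definition nth_eigenvalue ::
    "('a \<Rightarrow> real) \<Rightarrow> ('a \<Rightarrow> real) set \<Rightarrow> (('a \<Rightarrow> real) \<Rightarrow> 'a \<Rightarrow> real) \<Rightarrow> nat \<Rightarrow> real" where
  "nth_eigenvalue m DL L n = (THE t. \<exists>lam. eigenvalue_listing m DL L lam \<and> lam n = t)"

end

theory Submission
  imports Defs
begin

text \<open>
  The forms satisfy \<open>Q\<^sub>0 \<le> Q\<^sub>c\<close>, so a lowest eigenvector \<open>f\<close> of \<open>Q\<^sub>c\<close> with eigenvalue
  \<open>\<lambda>\<^sub>1(c) = \<lambda>\<^sub>1(0)\<close> is also a minimizer of the Rayleigh quotient of \<open>Q\<^sub>0\<close>, hence an eigenvector of
  \<open>Q\<^sub>0\<close> with \<open>Q\<^sub>c(f, f) = Q\<^sub>0(f, f)\<close>, that is \<open>\<Sum>\<^sub>x c(x) f(x)\<^sup>2 = 0\<close>. As multiplicities agree, the lowest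
  eigenspaces coincide, and the argument repeats in their orthogonal complement. Thus \<open>c f\<^sup>2 = 0\<close> for
  all eigenvectors \<open>f\<close>; by completeness no point of \<open>X\<close> is a common zero of these, and \<open>c = 0\<close>. As
  \<open>c/m\<close> is bounded, the two form domains are equal and \<open>Q\<^sub>c\<close> inherits closedness and compact
  embedding from \<open>Q\<^sub>0\<close>.
\<close>


section \<open>Nonnegative symmetric forms\<close>

locale psd_form = vector_space scl
  for scl :: "real \<Rightarrow> 'v::ab_group_add \<Rightarrow> 'v" +
  fixes W :: "'v set" and B :: "'v \<Rightarrow> 'v \<Rightarrow> real"
  assumes subspace: "subspace W"
    and sym: "\<lbrakk>u \<in> W; v \<in> W\<rbrakk> \<Longrightarrow> B u v = B v u"
    and add_left: "\<lbrakk>u \<in> W; v \<in> W; w \<in> W\<rbrakk> \<Longrightarrow> B (u + v) w = B u w + B v w"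
    and scale_left: "\<lbrakk>u \<in> W; v \<in> W\<rbrakk> \<Longrightarrow> B (scl r u) v = r * B u v"
    and nonneg: "u \<in> W \<Longrightarrow> 0 \<le> B u u"
begin

lemmas mem_closed = subspace_0[OF subspace] subspace_add[OF subspace]
  subspace_diff[OF subspace] subspace_scale[OF subspace] subspace_sum[OF subspace]

lemma add_right: "\<lbrakk>u \<in> W; v \<in> W; w \<in> W\<rbrakk> \<Longrightarrow> B w (u + v) = B w u + B w v"
  by (metis add_left sym mem_closed(2))

lemma scale_right: "\<lbrakk>u \<in> W; v \<in> W\<rbrakk> \<Longrightarrow> B v (scl r u) = r * B v u"
  by (metis scale_left sym mem_closed(4))

lemma diff_left: "\<lbrakk>u \<in> W; v \<in> W; w \<in> W\<rbrakk> \<Longrightarrow> B (u - v) w = B u w - B v w"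
  by (metis add_diff_cancel_right' add_left diff_add_cancel mem_closed(3))

lemma diff_right: "\<lbrakk>u \<in> W; v \<in> W; w \<in> W\<rbrakk> \<Longrightarrow> B w (u - v) = B w u - B w v"
  by (metis diff_left sym mem_closed(3))

lemma zero_left: "v \<in> W \<Longrightarrow> B 0 v = 0"
  using diff_left[of 0 0 v] mem_closed(1) by simp

lemma sum_left:
  assumes "finite F" "\<And>i. i \<in> F \<Longrightarrow> f i \<in> W" "v \<in> W"
  shows "B (\<Sum>i\<in>F. f i) v = (\<Sum>i\<in>F. B (f i) v)"
  using assms
proof (induction F)
  case empty
  then show ?case by (simp add: zero_left)
next
  case (insert x F)
  then show ?case by (simp add: add_left mem_closed(5))
qed

lemma expand_add: "\<lbrakk>u \<in> W; v \<in> W\<rbrakk> \<Longrightarrow> B (u + v) (u + v) = B u u + 2 * B u v + B v v"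
  using sym[of u v] by (simp add: add_left add_right mem_closed)

lemma expand_diff: "\<lbrakk>u \<in> W; v \<in> W\<rbrakk> \<Longrightarrow> B (u - v) (u - v) = B u u - 2 * B u v + B v v"
  using sym[of u v] by (simp add: diff_left diff_right mem_closed)

lemma expand_scale: "u \<in> W \<Longrightarrow> B (scl r u) (scl r u) = r\<^sup>2 * B u u"
  by (simp add: scale_left scale_right mem_closed power2_eq_square)

text \<open>The form may be degenerate, so \<open>B v v = 0\<close> is treated apart: there the
  nonnegative quadratic in \<open>t\<close> becomes affine, which forces
  \<open>B u v = 0\<close>.\<close>

lemma Cauchy_Schwarz:
  assumes "u \<in> W" "v \<in> W"
  shows "(B u v)\<^sup>2 \<le> B u u * B v v"
proof -
  have *: "0 \<le> B u u - 2 * (t * B u v) + t\<^sup>2 * B v v" for t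
    using nonneg[of "u - scl t v"] assms
    by (simp add: expand_diff scale_left scale_right mem_closed power2_eq_square mult.assoc)
  show ?thesis
  proof (cases "B v v = 0")
    case True
    have "B u v = 0"
    proof (rule ccontr)
      assume "B u v \<noteq> 0"
      \<comment> \<open>This \<open>t\<close> gives \<open>B u u - 2 * (t * B u v)\<close> the value
        \<open>-1\<close>.\<close>
      then show False
        using *[of "(B u u + 1) / (2 * B u v)"] True by simp
    qed
    then show ?thesis using True by simp
  next
    case False
    then have pos: "0 < B v v" using nonneg[OF assms(2)] by simp
    have "0 \<le> B u u - (B u v)\<^sup>2 / B v v"
      using *[of "B u v / B v v"] pos by (simp add: power2_eq_square field_simps)
    then show ?thesis using pos by (simp add: field_simps)
  qed
qed

text \<open>A zero of a nonnegative quadratic form is a minimum; Cauchy-Schwarz makes the first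
  variation vanish there without any differentiation.\<close>

lemma null_vector: "\<lbrakk>u \<in> W; v \<in> W; B u u = 0\<rbrakk> \<Longrightarrow> B u v = 0"
  using Cauchy_Schwarz[of u v] by simp

lemma triangle_add:
  assumes "u \<in> W" "v \<in> W"
  shows "sqrt (B (u + v) (u + v)) \<le> sqrt (B u u) + sqrt (B v v)"
proof (rule real_le_lsqrt)
  have "B u v \<le> sqrt (B u u * B v v)"
    using Cauchy_Schwarz[OF assms] real_le_rsqrt by blast
  then show "B (u + v) (u + v) \<le> (sqrt (B u u) + sqrt (B v v))\<^sup>2"
    using assms by (simp add: expand_add power2_sum nonneg real_sqrt_mult)
qed (simp add: assms nonneg)

lemma triangle_diff:
  assumes "u \<in> W" "v \<in> W" "w \<in> W"
  shows "sqrt (B (u - w) (u - w)) \<le> sqrt (B (u - v) (u - v)) + sqrt (B (v - w) (v - w))"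
  using triangle_add[of "u - v" "v - w"] assms by (simp add: mem_closed)

text \<open>Convergence is in the seminorm of \<open>B\<close> itself. Cauchy-Schwarz gives the
  linear limit; the quadratic one follows by expanding \<open>B (u k - l) (u k - l)\<close> and
  using the linear limit against \<open>l\<close>.\<close>

lemma tendsto_form:
  assumes u: "\<And>k. u k \<in> W" and l: "l \<in> W" and v: "v \<in> W"
    and lim: "(\<lambda>k. B (u k - l) (u k - l)) \<longlonglongrightarrow> 0"
  shows "(\<lambda>k. B (u k) v) \<longlonglongrightarrow> B l v" and "(\<lambda>k. B (u k) (u k)) \<longlonglongrightarrow> B l l"
proof -
  have one: "(\<lambda>k. B (u k) w) \<longlonglongrightarrow> B l w" if w: "w \<in> W" for w
  proof -
    have "(\<lambda>k. (B (u k - l) w)\<^sup>2) \<longlonglongrightarrow> 0"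
    proof (rule tendsto_sandwich[OF always_eventually always_eventually tendsto_const])
      show "(\<lambda>k. B (u k - l) (u k - l) * B w w) \<longlonglongrightarrow> 0"
        using tendsto_mult[OF lim tendsto_const[of "B w w"]] by simp
    qed (use u l w in \<open>auto intro!: Cauchy_Schwarz mem_closed\<close>)
    then have "(\<lambda>k. B (u k - l) w) \<longlonglongrightarrow> 0"
      using tendsto_real_sqrt by (fastforce simp: tendsto_rabs_zero_iff)
    then show ?thesis
      using u l w by (simp add: diff_left LIM_zero_iff)
  qed
  then show "(\<lambda>k. B (u k) v) \<longlonglongrightarrow> B l v" using v by blast
  have "(\<lambda>k. B (u k - l) (u k - l) + 2 * B (u k) l - B l l) \<longlonglongrightarrow> 0 + 2 * B l l - B l l"
    by (intro tendsto_intros lim one l)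
  then show "(\<lambda>k. B (u k) (u k)) \<longlonglongrightarrow> B l l"
    using u l by (simp add: expand_diff)
qed

lemma psd_form_mono: "subspace V \<Longrightarrow> V \<subseteq> W \<Longrightarrow> psd_form scl V B"
  by unfold_locales (auto simp: sym add_left scale_left nonneg subset_iff)

end

lemma psd_form_add:
  assumes "psd_form scl W A" "psd_form scl W B"
  shows "psd_form scl W (\<lambda>u v. A u v + B u v)"
proof -
  interpret A: psd_form scl W A by fact
  interpret B: psd_form scl W B by fact
  show ?thesis
    by unfold_locales
      (auto simp: A.subspace A.add_left B.add_left A.scale_left B.scale_left A.nonneg B.nonneg
        algebra_simps intro!: arg_cong2[of _ _ _ _ "(+)"] A.sym B.sym)
qed

text \<open>\<open>pos\<close> and \<open>minus\<close> range over all vectors because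
  \<open>Metric_space\<close> demands nonnegativity and symmetry of the distance outside the carrier
  as well.\<close>

lemma Metric_space_form:
  assumes "psd_form scl D B" and definite: "\<And>u. u \<in> D \<Longrightarrow> B u u = 0 \<Longrightarrow> u = 0"
    and pos: "\<And>u. 0 \<le> B u u" and minus: "\<And>u v. B (u - v) (u - v) = B (v - u) (v - u)"
  shows "Metric_space D (\<lambda>u v. sqrt (B (u - v) (u - v)))"
proof -
  interpret psd_form scl D B by fact
  show ?thesis
  proof
    fix u v assume uv: "u \<in> D" "v \<in> D"
    have "B (u - v) (u - v) = 0 \<longleftrightarrow> u - v = 0"
      using definite[of "u - v"] mem_closed uv zero_left[of 0] by auto
    then show "sqrt (B (u - v) (u - v)) = 0 \<longleftrightarrow> u = v" by simp
    show "sqrt (B (u - w) (u - w)) \<le> sqrt (B (u - v) (u - v)) + sqrt (B (v - w) (v - w))"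
      if "w \<in> D" for w
      using triangle_diff[OF uv that] .
  next
    show "sqrt (B (u - v) (u - v)) = sqrt (B (v - u) (v - u))" for u v
      by (simp only: minus)
  qed (simp add: pos)
qed


section \<open>Spectral decomposition of closed forms with compact embedding\<close>

text \<open>Everything takes place in the form domain \<open>D\<close>: the ambient Hilbert space enters only
  through its inner product, and eigenvectors are understood in the weak sense.\<close>

locale compact_form = vector_space scl
  for scl :: "real \<Rightarrow> 'v::ab_group_add \<Rightarrow> 'v" +
  fixes D :: "'v set" and ip Q :: "'v \<Rightarrow> 'v \<Rightarrow> real"
  assumes psd_inner: "psd_form scl D ip"
    and psd_form: "psd_form scl D Q"
    and definite: "\<lbrakk>u \<in> D; ip u u = 0\<rbrakk> \<Longrightarrow> u = 0"
    and compact: "\<And>(u :: nat \<Rightarrow> 'v) C. \<lbrakk>\<And>k. u k \<in> D; \<And>k. ip (u k) (u k) + Q (u k) (u k) \<le> C\<rbrakk> \<Longrightarrow>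
      \<exists>r :: nat \<Rightarrow> nat. strict_mono r \<and>
        (\<forall>\<epsilon>>0. \<exists>N. \<forall>i\<ge>N. \<forall>j\<ge>N. ip (u (r i) - u (r j)) (u (r i) - u (r j)) < \<epsilon>)"
    and complete: "\<And>u :: nat \<Rightarrow> 'v. \<lbrakk>\<And>k. u k \<in> D;
        \<forall>\<epsilon>>0. \<exists>N. \<forall>i\<ge>N. \<forall>j\<ge>N. ip (u i - u j) (u i - u j) + Q (u i - u j) (u i - u j) < \<epsilon>\<rbrakk> \<Longrightarrow>
      \<exists>l\<in>D. (\<lambda>k. ip (u k - l) (u k - l) + Q (u k - l) (u k - l)) \<longlonglongrightarrow> 0"
begin

sublocale inner: psd_form scl D ip by (fact psd_inner)
sublocale form: psd_form scl D Q by (fact psd_form)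

section \<open>Orthogonal complements, weak eigenspaces and minimizers\<close>

definition perp :: "'v set \<Rightarrow> 'v set" where
  "perp S = {v \<in> D. \<forall>s\<in>S. ip v s = 0}"

definition weak_eigenspace :: "real \<Rightarrow> 'v set" where
  "weak_eigenspace t = {u \<in> D. \<forall>v\<in>D. Q u v = t * ip u v}"

definition orthonormal :: "'v set \<Rightarrow> bool" where
  "orthonormal S \<longleftrightarrow> S \<subseteq> D \<and> (\<forall>s\<in>S. \<forall>s'\<in>S. ip s s' = (if s = s' then 1 else 0))"

lemma perp_subset: "perp S \<subseteq> D"
  by (auto simp: perp_def)

lemma perp_antimono: "S \<subseteq> T \<Longrightarrow> perp T \<subseteq> perp S"
  by (auto simp: perp_def)

lemma subspace_perp: "S \<subseteq> D \<Longrightarrow> subspace (perp S)"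
  by (rule subspaceI)
    (auto simp: perp_def inner.mem_closed inner.zero_left inner.add_left inner.scale_left subset_iff)

lemma subspace_weak_eigenspace: "subspace (weak_eigenspace t)"
  by (rule subspaceI)
    (auto simp: weak_eigenspace_def inner.mem_closed inner.zero_left form.zero_left inner.add_left
      form.add_left inner.scale_left form.scale_left algebra_simps)

lemma weak_eigenspace_subset: "weak_eigenspace t \<subseteq> D"
  by (auto simp: weak_eigenspace_def)

lemma weak_eigenspaceD: "\<lbrakk>u \<in> weak_eigenspace t; v \<in> D\<rbrakk> \<Longrightarrow> Q u v = t * ip u v"
  by (auto simp: weak_eigenspace_def)

lemma weak_eigenspaces_orthogonal:
  assumes "u \<in> weak_eigenspace s" "v \<in> weak_eigenspace t" "s \<noteq> t"
  shows "ip u v = 0"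
proof -
  have uv: "u \<in> D" "v \<in> D"
    using assms weak_eigenspace_subset by auto
  have "s * ip u v = Q u v"
    using assms uv by (simp add: weak_eigenspaceD)
  also have "\<dots> = t * ip u v"
    using assms uv form.sym[of u v] inner.sym[of u v] by (simp add: weak_eigenspaceD)
  finally show ?thesis using assms(3) by simp
qed

text \<open>Direct method: a minimizing sequence of unit vectors is bounded in the form norm, so
  \<open>compact\<close> gives a subsequence that is Cauchy for \<open>ip\<close>. The parallelogram
  identity makes it Cauchy for \<open>Q\<close> too, and \<open>complete\<close> then supplies the
  limit in \<open>D\<close>.\<close>

lemma exists_minimizer:
  assumes S: "S \<subseteq> D" and w: "w \<in> perp S" "w \<noteq> 0"
  shows "\<exists>u\<in>perp S. ip u u = 1 \<and> (\<forall>v\<in>perp S. Q u u * ip v v \<le> Q v v)"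
proof -
  interpret P: psd_form scl "perp S" ip
    by (rule inner.psd_form_mono[OF subspace_perp[OF S] perp_subset])
  have inD: "v \<in> D" if "v \<in> perp S" for v using that by (simp add: perp_def)
  have pos: "0 < ip v v" if "v \<in> perp S" "v \<noteq> 0" for v
    using that inD definite[of v] inner.nonneg[of v] by fastforce
  define V where "V = {v \<in> perp S. ip v v = 1}"
  have normalize: "scl (1 / sqrt (ip v v)) v \<in> V" if "v \<in> perp S" "v \<noteq> 0" for v
    using that pos[OF that] inD
    by (simp add: V_def P.mem_closed inner.expand_scale power_divide)
  define lam where "lam = Inf ((\<lambda>v. Q v v) ` V)"
  have bdd: "bdd_below ((\<lambda>v. Q v v) ` V)"
    by (rule bdd_belowI[of _ 0]) (auto simp: V_def inD form.nonneg)
  have ne: "V \<noteq> {}" using normalize[OF w] by auto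
  have low: "lam * ip v v \<le> Q v v" if "v \<in> perp S" for v
  proof (cases "v = 0")
    case True
    then show ?thesis by (simp add: inner.zero_left form.zero_left inner.mem_closed)
  next
    case False
    have "lam \<le> Q (scl (1 / sqrt (ip v v)) v) (scl (1 / sqrt (ip v v)) v)"
      unfolding lam_def by (rule cINF_lower[OF bdd normalize[OF that False]])
    then show ?thesis
      using pos[OF that False] inD[OF that]
      by (simp add: form.expand_scale power_divide field_simps)
  qed
  have lam0: "0 \<le> lam"
    unfolding lam_def using ne by (intro cINF_greatest) (auto simp: V_def inD form.nonneg)
  have "\<exists>v\<in>V. Q v v < lam + 1 / real (Suc k)" for k
    using cINF_less_iff[OF ne bdd, of "lam + 1 / real (Suc k)"] unfolding lam_def by auto
  then obtain v where v: "\<And>k. v k \<in> V" "\<And>k. Q (v k) (v k) < lam + 1 / real (Suc k)"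
    by metis
  have vS: "v k \<in> perp S" and vD: "v k \<in> D" and v1: "ip (v k) (v k) = 1" for k
    using v(1)[of k] by (auto simp: V_def inD)
  have "ip (v k) (v k) + Q (v k) (v k) \<le> 1 + (lam + 1)" for k
  proof -
    have "1 / real (Suc k) \<le> 1" by simp
    then show ?thesis using v(2)[of k] v1[of k] by linarith
  qed
  then obtain r :: "nat \<Rightarrow> nat" where r: "strict_mono r"
    and cau: "\<forall>\<epsilon>>0. \<exists>N. \<forall>i\<ge>N. \<forall>j\<ge>N. ip (v (r i) - v (r j)) (v (r i) - v (r j)) < \<epsilon>"
    using compact[of v, OF vD] by blast
  define w where "w k = v (r k)" for k
  have wS: "w k \<in> perp S" and wD: "w k \<in> D" and w1: "ip (w k) (w k) = 1" for k
    by (simp_all add: w_def vS vD v1)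
  have Qw_lim: "(\<lambda>k. Q (w k) (w k)) \<longlonglongrightarrow> lam"
  proof (rule tendsto_sandwich[OF always_eventually always_eventually tendsto_const])
    show "\<forall>k. lam \<le> Q (w k) (w k)" using low[OF wS] w1 by simp
    show "\<forall>k. Q (w k) (w k) \<le> lam + 1 / real (Suc k)"
    proof
      fix k
      have "1 / real (Suc (r k)) \<le> 1 / real (Suc k)"
        using seq_suble[OF r, of k] by (simp add: field_simps)
      then show "Q (w k) (w k) \<le> lam + 1 / real (Suc k)"
        using v(2)[of "r k"] by (simp add: w_def)
    qed
    show "(\<lambda>k. lam + 1 / real (Suc k)) \<longlonglongrightarrow> lam"
      using tendsto_add[OF tendsto_const LIMSEQ_inverse_real_of_nat, of lam]
      by (simp add: inverse_eq_divide)
  qed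
  \<comment> \<open>Parallelogram identity for \<open>Q\<close> and for \<open>ip\<close>, where
    \<open>Q (w i + w j) (w i + w j)\<close> is bounded below by \<open>low\<close>; unit length
    accounts for the \<open>4\<close>.\<close>
  have key: "Q (w i - w j) (w i - w j) \<le>
      2 * (Q (w i) (w i) - lam) + 2 * (Q (w j) (w j) - lam) + lam * ip (w i - w j) (w i - w j)"
    for i j
  proof -
    have "lam * ip (w i + w j) (w i + w j) \<le> Q (w i + w j) (w i + w j)"
      by (rule low) (simp add: P.mem_closed wS)
    moreover have "ip (w i + w j) (w i + w j) = 4 - ip (w i - w j) (w i - w j)"
      using wD by (simp add: inner.expand_add inner.expand_diff w1)
    moreover have "Q (w i - w j) (w i - w j) =
        2 * Q (w i) (w i) + 2 * Q (w j) (w j) - Q (w i + w j) (w i + w j)"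
      using wD by (simp add: form.expand_add form.expand_diff)
    ultimately show ?thesis by (simp add: algebra_simps)
  qed
  have "\<exists>N. \<forall>i\<ge>N. \<forall>j\<ge>N. ip (w i - w j) (w i - w j) + Q (w i - w j) (w i - w j) < \<epsilon>"
    if "\<epsilon> > 0" for \<epsilon>
  proof -
    have "\<epsilon> / (2 * (1 + lam)) > 0" using that lam0 by simp
    then obtain N1 where N1: "\<forall>i\<ge>N1. \<forall>j\<ge>N1. ip (w i - w j) (w i - w j) < \<epsilon> / (2 * (1 + lam))"
      using cau unfolding w_def by blast
    have "\<forall>\<^sub>F k in sequentially. Q (w k) (w k) < lam + \<epsilon> / 8"
      using order_tendstoD(2)[OF Qw_lim] that by simp
    then obtain N2 where N2: "\<forall>k\<ge>N2. Q (w k) (w k) < lam + \<epsilon> / 8"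
      by (auto simp: eventually_sequentially)
    have "ip (w i - w j) (w i - w j) + Q (w i - w j) (w i - w j) < \<epsilon>"
      if ij: "i \<ge> max N1 N2" "j \<ge> max N1 N2" for i j
    proof -
      \<comment> \<open>By \<open>key\<close> the total stays below
        \<open>\<epsilon> / 2 + \<epsilon> / 4 + \<epsilon> / 4\<close>.\<close>
      have "(1 + lam) * ip (w i - w j) (w i - w j) < \<epsilon> / 2"
        using N1 ij lam0 by (simp add: field_simps)
      moreover have "Q (w i) (w i) < lam + \<epsilon> / 8" "Q (w j) (w j) < lam + \<epsilon> / 8"
        using N2 ij by auto
      ultimately show ?thesis using key[of i j] by (simp add: algebra_simps)
    qed
    then show ?thesis by blast
  qed
  then obtain l where l: "l \<in> D"
    and lim: "(\<lambda>k. ip (w k - l) (w k - l) + Q (w k - l) (w k - l)) \<longlonglongrightarrow> 0"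
    using complete[of w, OF wD] by blast
  have nn: "0 \<le> ip (w k - l) (w k - l)" "0 \<le> Q (w k - l) (w k - l)" for k
    using wD l by (auto intro!: inner.nonneg form.nonneg inner.mem_closed)
  have lim1: "(\<lambda>k. ip (w k - l) (w k - l)) \<longlonglongrightarrow> 0"
    by (rule tendsto_sandwich[OF always_eventually always_eventually tendsto_const lim])
      (simp_all add: nn)
  have lim2: "(\<lambda>k. Q (w k - l) (w k - l)) \<longlonglongrightarrow> 0"
    by (rule tendsto_sandwich[OF always_eventually always_eventually tendsto_const lim])
      (simp_all add: nn)
  \<comment> \<open>Both constraints, orthogonality to \<open>S\<close> and unit length, survive the
    limit.\<close>
  have "ip l s = 0" if "s \<in> S" for s
  proof (rule LIMSEQ_unique)
    show "(\<lambda>k. ip (w k) s) \<longlonglongrightarrow> ip l s"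
      using inner.tendsto_form(1)[OF wD l _ lim1] that S by blast
    show "(\<lambda>k. ip (w k) s) \<longlonglongrightarrow> 0"
      using wS that by (simp add: perp_def)
  qed
  then have "l \<in> perp S" using l by (simp add: perp_def)
  moreover have "ip l l = 1"
    using LIMSEQ_unique[OF inner.tendsto_form(2)[OF wD l l lim1]] w1 by simp
  moreover have "Q l l = lam"
    using LIMSEQ_unique[OF form.tendsto_form(2)[OF wD l l lim2] Qw_lim] .
  ultimately show ?thesis using low by blast
qed

lemma project_perp:
  assumes "finite S" "orthonormal S" "v \<in> D"
  shows "v - (\<Sum>s\<in>S. scl (ip v s) s) \<in> perp S"
proof -
  have SD: "s \<in> D" if "s \<in> S" for s using that assms by (auto simp: orthonormal_def)
  have sumD: "(\<Sum>s\<in>S. scl (ip v s) s) \<in> D"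
    using SD by (intro inner.mem_closed) auto
  have "ip (\<Sum>s\<in>S. scl (ip v s) s) s' = ip v s'" if s': "s' \<in> S" for s'
  proof -
    have "ip (\<Sum>s\<in>S. scl (ip v s) s) s' = (\<Sum>s\<in>S. ip v s * ip s s')"
      using SD s' assms(1) by (simp add: inner.sum_left inner.mem_closed inner.scale_left)
    also have "\<dots> = (\<Sum>s\<in>S. if s = s' then ip v s else 0)"
      using assms(2) s' by (intro sum.cong) (auto simp: orthonormal_def)
    finally show ?thesis using s' assms(1) by simp
  qed
  then show ?thesis
    using sumD assms(3) SD by (simp add: perp_def inner.diff_left inner.mem_closed)
qed

text \<open>Euler--Lagrange: \<open>Q - t\<cdot>ip\<close> is nonnegative on \<open>perp S\<close> and vanishes at \<open>u\<close>, so by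
  Cauchy--Schwarz \<open>u\<close> lies in its radical.\<close>

lemma minimizer_is_eigenvector:
  assumes S: "finite S" "orthonormal S"
    and eig: "\<And>s. s \<in> S \<Longrightarrow> \<exists>\<mu>. s \<in> weak_eigenspace \<mu>"
    and u: "u \<in> perp S" "Q u u = t * ip u u"
    and min: "\<And>v. v \<in> perp S \<Longrightarrow> t * ip v v \<le> Q v v"
  shows "u \<in> weak_eigenspace t"
proof -
  have SD: "S \<subseteq> D" using S by (auto simp: orthonormal_def)
  have uD: "u \<in> D" using u perp_subset by auto
  interpret R: psd_form scl "perp S" "\<lambda>u v. Q u v - t * ip u v"
    by unfold_locales
      (use subspace_perp[OF SD] perp_subset[of S] min in \<open>auto simp: subset_iff inner.sym form.sym
        inner.add_left form.add_left inner.scale_left form.scale_left algebra_simps\<close>)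
  have "Q u v = t * ip u v" if v: "v \<in> D" for v
  proof -
    \<comment> \<open>Split \<open>v\<close> into \<open>p\<close> and \<open>v - p\<close>. The
      radical argument covers \<open>v - p\<close>, which lies in \<open>perp S\<close>;
      \<open>p\<close> is a combination of eigenvectors orthogonal to \<open>u\<close>, so
      \<open>Q\<close> and \<open>ip\<close> both vanish on it against \<open>u\<close>.\<close>
    define p where "p = (\<Sum>s\<in>S. scl (ip v s) s)"
    have pD: "p \<in> D" unfolding p_def using SD by (intro inner.mem_closed) auto
    have vp: "v - p \<in> perp S" unfolding p_def by (rule project_perp[OF S v])
    have "Q u (v - p) - t * ip u (v - p) = 0"
      using R.null_vector[OF u(1) vp] u(2) by simp
    moreover have "ip s u = 0" "Q s u = 0" if s: "s \<in> S" for s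
    proof -
      show *: "ip s u = 0" using u(1) s SD uD inner.sym[of s u] by (auto simp: perp_def)
      show "Q s u = 0" using eig[OF s] uD * by (auto simp: weak_eigenspaceD)
    qed
    then have "ip p u = 0" "Q p u = 0"
      unfolding p_def using SD uD S(1)
      by (simp_all add: inner.sum_left form.sum_left inner.mem_closed inner.scale_left
          form.scale_left subset_iff)
    then have "ip u p = 0" "Q u p = 0"
      using inner.sym[OF uD pD] form.sym[OF uD pD] by auto
    ultimately show ?thesis
      using uD v pD by (simp add: inner.diff_right form.diff_right)
  qed
  then show ?thesis using uD by (simp add: weak_eigenspace_def)
qed

lemma orthonormal_independent:
  assumes "orthonormal S"
  shows "independent S"
  unfolding dependent_explicit
proof safe
  fix T a s
  assume T: "finite T" "T \<subseteq> S" "(\<Sum>v\<in>T. scl (a v) v) = 0" and s: "s \<in> T" "a s \<noteq> 0"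
  have TD: "v \<in> D" if "v \<in> T" for v using that T assms by (auto simp: orthonormal_def)
  have "ip (\<Sum>v\<in>T. scl (a v) v) s = (\<Sum>v\<in>T. a v * ip v s)"
    using T(1) TD s(1) by (simp add: inner.sum_left inner.mem_closed inner.scale_left)
  also have "\<dots> = (\<Sum>v\<in>T. if v = s then a v else 0)"
    using assms T s by (intro sum.cong) (auto simp: orthonormal_def subset_iff)
  also have "\<dots> = a s" using T(1) s(1) by simp
  finally show False using T(3) s TD by (simp add: inner.zero_left)
qed

end

text \<open>Adding \<open>R\<close> strengthens the form norm, so boundedness and the Cauchy
  property pass to \<open>Q\<close>; the bound by \<open>K * ip\<close> makes the two norms
  equivalent, so the limit found for \<open>Q\<close> is also a limit for the sum.\<close>

lemma (in compact_form) compact_form_perturb: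
  assumes R: "psd_form scl D R" and le: "\<And>u. u \<in> D \<Longrightarrow> R u u \<le> K * ip u u"
  shows "compact_form scl D ip (\<lambda>u v. Q u v + R u v)"
proof -
  interpret R: psd_form scl D R by fact
  interpret S: psd_form scl D "\<lambda>u v. Q u v + R u v"
    by (rule psd_form_add[OF psd_form R])
  show ?thesis
  proof unfold_locales
    fix u :: "nat \<Rightarrow> 'v" and C
    assume u: "\<And>k. u k \<in> D" and le: "\<And>k. ip (u k) (u k) + (Q (u k) (u k) + R (u k) (u k)) \<le> C"
    have "ip (u k) (u k) + Q (u k) (u k) \<le> C" for k
      using le[of k] R.nonneg[OF u[of k]] by linarith
    then show "\<exists>r :: nat \<Rightarrow> nat. strict_mono r \<and>
        (\<forall>\<epsilon>>0. \<exists>N. \<forall>i\<ge>N. \<forall>j\<ge>N. ip (u (r i) - u (r j)) (u (r i) - u (r j)) < \<epsilon>)"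
      using compact[of u, OF u] by blast
  next
    fix u :: "nat \<Rightarrow> 'v"
    assume u: "\<And>k. u k \<in> D"
      and cau: "\<forall>\<epsilon>>0. \<exists>N. \<forall>i\<ge>N. \<forall>j\<ge>N. ip (u i - u j) (u i - u j) +
        (Q (u i - u j) (u i - u j) + R (u i - u j) (u i - u j)) < \<epsilon>"
    have "0 \<le> R (u i - u j) (u i - u j)" for i j
      using u by (simp add: R.nonneg R.mem_closed)
    then have "ip (u i - u j) (u i - u j) + Q (u i - u j) (u i - u j) \<le> ip (u i - u j) (u i - u j) +
        (Q (u i - u j) (u i - u j) + R (u i - u j) (u i - u j))" for i j
      by simp
    then have "\<forall>\<epsilon>>0. \<exists>N. \<forall>i\<ge>N. \<forall>j\<ge>N. ip (u i - u j) (u i - u j) + Q (u i - u j) (u i - u j) < \<epsilon>"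
      using cau by (meson le_less_trans)
    then obtain l where l: "l \<in> D"
      and lim: "(\<lambda>k. ip (u k - l) (u k - l) + Q (u k - l) (u k - l)) \<longlonglongrightarrow> 0"
      using complete[of u, OF u] by blast
    have ul: "u k - l \<in> D" for k using u l by (simp add: R.mem_closed)
    have "(\<lambda>k. ip (u k - l) (u k - l) + (Q (u k - l) (u k - l) + R (u k - l) (u k - l))) \<longlonglongrightarrow> 0"
    proof (rule tendsto_sandwich[OF always_eventually always_eventually tendsto_const])
      show "(\<lambda>k. (1 + \<bar>K\<bar>) * (ip (u k - l) (u k - l) + Q (u k - l) (u k - l))) \<longlonglongrightarrow> 0"
        using tendsto_mult[OF tendsto_const lim] by simp
      show "\<forall>k. ip (u k - l) (u k - l) + (Q (u k - l) (u k - l) + R (u k - l) (u k - l))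
          \<le> (1 + \<bar>K\<bar>) * (ip (u k - l) (u k - l) + Q (u k - l) (u k - l))"
      proof
        fix k
        have "R (u k - l) (u k - l) \<le> \<bar>K\<bar> * ip (u k - l) (u k - l)"
          using assms(2)[OF ul[of k]] inner.nonneg[OF ul[of k]]
          by (meson abs_ge_self mult_right_mono order_trans)
        moreover have "0 \<le> \<bar>K\<bar> * Q (u k - l) (u k - l)"
          using form.nonneg[OF ul] by simp
        ultimately show "ip (u k - l) (u k - l) + (Q (u k - l) (u k - l) + R (u k - l) (u k - l))
          \<le> (1 + \<bar>K\<bar>) * (ip (u k - l) (u k - l) + Q (u k - l) (u k - l))"
          by (simp add: algebra_simps)
      qed
      show "\<forall>k. 0 \<le> ip (u k - l) (u k - l) + (Q (u k - l) (u k - l) + R (u k - l) (u k - l))"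
        using inner.nonneg[OF ul] S.nonneg[OF ul] by (simp add: add_nonneg_nonneg)
    qed
    then show "\<exists>l\<in>D. (\<lambda>k. ip (u k - l) (u k - l) +
        (Q (u k - l) (u k - l) + R (u k - l) (u k - l))) \<longlonglongrightarrow> 0"
      using l by blast
  qed (fact definite)
qed

text \<open>Eigenvectors are chosen one at a time as minimizers in the orthogonal complement of the
  previous ones; \<open>e n = 0\<close> once the whole space is exhausted.\<close>

locale greedy_sequence = compact_form scl D ip Q
  for scl :: "real \<Rightarrow> 'v::ab_group_add \<Rightarrow> 'v" and D :: "'v set" and ip Q :: "'v \<Rightarrow> 'v \<Rightarrow> real" +
  fixes e :: "nat \<Rightarrow> 'v"
  assumes pick: "\<exists>w\<in>perp (e ` {..<n}). w \<noteq> 0 \<Longrightarrow> e n \<in> perp (e ` {..<n}) \<and> ip (e n) (e n) = 1 \<and>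
      (\<forall>v\<in>perp (e ` {..<n}). Q (e n) (e n) * ip v v \<le> Q v v)"
    and exhausted: "\<not> (\<exists>w\<in>perp (e ` {..<n}). w \<noteq> 0) \<Longrightarrow> e n = 0"

text \<open>Course-of-values choice: the condition on the \<open>n\<close>-th vector involves only
  the values below \<open>n\<close>. The clause \<open>r \<in> D\<close> in \<open>?P\<close> is the
  invariant that makes \<open>exists_minimizer\<close> applicable to the earlier vectors.\<close>

lemma (in compact_form) exists_greedy_sequence: "\<exists>e. greedy_sequence scl D ip Q e"
proof -
  let ?P = "\<lambda>e n r. r \<in> D \<and>
    (if \<exists>w\<in>perp (e ` {..<n}). w \<noteq> 0 then r \<in> perp (e ` {..<n}) \<and> ip r r = 1 \<and>
      (\<forall>v\<in>perp (e ` {..<n}). Q r r * ip v v \<le> Q v v) else r = 0)"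
  have "\<exists>e. \<forall>n::nat. ?P e n (e n)"
  proof (rule dependent_wellorder_choice)
    fix r :: 'v and f g :: "nat \<Rightarrow> 'v" and n
    assume "\<And>k. k < n \<Longrightarrow> f k = g k"
    then have "f ` {..<n} = g ` {..<n}" by auto
    then show "?P f n r = ?P g n r" by (simp only:)
  next
    fix n and f :: "nat \<Rightarrow> 'v"
    assume "\<And>k. k < n \<Longrightarrow> ?P f k (f k)"
    from conjunct1[OF this] have fD: "f ` {..<n} \<subseteq> D" by auto
    show "\<exists>r. ?P f n r"
    proof (cases "\<exists>w\<in>perp (f ` {..<n}). w \<noteq> 0")
      case True
      then obtain u where "u \<in> perp (f ` {..<n})" "ip u u = 1"
          "\<forall>v\<in>perp (f ` {..<n}). Q u u * ip v v \<le> Q v v"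
        using exists_minimizer[OF fD] by blast
      then show ?thesis using True perp_subset by (intro exI[of _ u]) auto
    next
      case False
      then show ?thesis using inner.mem_closed(1) by auto
    qed
  qed
  then obtain e where "\<forall>n::nat. ?P e n (e n)" ..
  then have "greedy_sequence scl D ip Q e"
    by unfold_locales (metis (no_types, lifting))+
  then show ?thesis by blast
qed

section \<open>Spectral properties of the greedy sequence\<close>

context greedy_sequence
begin

text \<open>An initial segment of the naturals with as many elements as the dimension of
  \<open>D\<close>; see \<open>alive_iff_independent\<close>. Counting starts at 0, whereas the
  eigenvalues are numbered from 1.\<close>

definition alive :: "nat set" where
  "alive = {n. \<exists>w\<in>perp (e ` {..<n}). w \<noteq> 0}"

definition lam :: "nat \<Rightarrow> real" where
  "lam n = Q (e n) (e n)"

lemma alive_downward: "\<lbrakk>n \<in> alive; k \<le> n\<rbrakk> \<Longrightarrow> k \<in> alive"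
  unfolding alive_def using perp_antimono[of "e ` {..<k}" "e ` {..<n}"] by fastforce

lemma e_perp: "n \<in> alive \<Longrightarrow> e n \<in> perp (e ` {..<n})"
  using pick[of n] by (simp add: alive_def)

lemma e_in_D: "n \<in> alive \<Longrightarrow> e n \<in> D"
  using e_perp perp_subset by auto

lemma e_unit: "n \<in> alive \<Longrightarrow> ip (e n) (e n) = 1"
  using pick[of n] by (simp add: alive_def)

lemma lam_minimal:
  assumes "n \<in> alive" "v \<in> D" "\<And>k. k < n \<Longrightarrow> ip v (e k) = 0"
  shows "lam n * ip v v \<le> Q v v"
  using pick[of n] assms by (auto simp: alive_def perp_def lam_def)

lemma e_orthonormal:
  assumes "i \<in> alive" "j \<in> alive"
  shows "ip (e i) (e j) = (if i = j then 1 else 0)"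
proof -
  have "ip (e i) (e j) = 0" if "j < i" "i \<in> alive" for i j
    using e_perp[OF that(2)] that(1) by (auto simp: perp_def)
  then show ?thesis
    using assms e_unit inner.sym[of "e i" "e j"] e_in_D by (metis linorder_neqE_nat)
qed

lemma inj_on_e: "inj_on e alive"
  by (rule inj_onI) (metis e_orthonormal zero_neq_one)

lemma orthonormal_image: "F \<subseteq> alive \<Longrightarrow> orthonormal (e ` F)"
  unfolding orthonormal_def using e_orthonormal e_in_D inj_onD[OF inj_on_e] by (fastforce simp: subset_iff)

lemma below_alive: "n \<in> alive \<Longrightarrow> {..<n} \<subseteq> alive"
  using alive_downward by (auto simp: less_imp_le)

text \<open>Strong induction, since \<open>minimizer_is_eigenvector\<close> needs all earlier
  vectors to be eigenvectors already.\<close>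

lemma e_eigenvector: "n \<in> alive \<Longrightarrow> e n \<in> weak_eigenspace (lam n)"
proof (induction n rule: less_induct)
  case (less n)
  show ?case
  proof (rule minimizer_is_eigenvector[of "e ` {..<n}"])
    show "orthonormal (e ` {..<n})"
      by (rule orthonormal_image[OF below_alive[OF less.prems]])
    show "\<exists>\<mu>. s \<in> weak_eigenspace \<mu>" if "s \<in> e ` {..<n}" for s
      using that less below_alive by auto
    show "Q (e n) (e n) = lam n * ip (e n) (e n)"
      using e_unit[OF less.prems] by (simp add: lam_def)
    show "lam n * ip v v \<le> Q v v" if "v \<in> perp (e ` {..<n})" for v
      using that lam_minimal[OF less.prems] by (auto simp: perp_def)
  qed (use e_perp less.prems in auto)
qed

text \<open>The later vector \<open>e j\<close> is a competitor in the minimization at stage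
  \<open>i\<close>.\<close>

lemma lam_mono: "\<lbrakk>i \<le> j; j \<in> alive\<rbrakk> \<Longrightarrow> lam i \<le> lam j"
  using lam_minimal[OF alive_downward, of j i "e j"] e_in_D[of j] e_unit[of j] e_orthonormal[of j]
    alive_downward[of j]
  by (auto simp: lam_def)

text \<open>Otherwise monotonicity puts every index in the set, and \<open>e\<close> is bounded in
  the form norm. Compactness would give a Cauchy subsequence, but distinct orthonormal vectors have
  squared distance 2.\<close>

lemma finite_lam_le: "finite {n \<in> alive. lam n \<le> t}"
proof (rule ccontr)
  assume inf: "infinite {n \<in> alive. lam n \<le> t}"
  have "n \<in> alive \<and> lam n \<le> t" for n
  proof -
    obtain k where "k > n" "k \<in> alive" "lam k \<le> t"
      using inf unfolding infinite_nat_iff_unbounded by blast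
    then show ?thesis
      using alive_downward lam_mono by (meson less_imp_le order_trans)
  qed
  then have al: "\<And>n. n \<in> alive" and le: "\<And>n. lam n \<le> t" by auto
  have "ip (e k) (e k) + Q (e k) (e k) \<le> 1 + t" for k
    using le[of k] e_unit[OF al[of k]] by (simp add: lam_def)
  then obtain r :: "nat \<Rightarrow> nat" where r: "strict_mono r"
    and "\<forall>\<epsilon>>0. \<exists>N. \<forall>i\<ge>N. \<forall>j\<ge>N. ip (e (r i) - e (r j)) (e (r i) - e (r j)) < \<epsilon>"
    using compact[of e, OF e_in_D[OF al]] by blast
  then obtain N where N: "ip (e (r i) - e (r j)) (e (r i) - e (r j)) < 1" if "i \<ge> N" "j \<ge> N" for i j
    by (meson zero_less_one)
  have "r N \<noteq> r (Suc N)" using strict_monoD[OF r, of N "Suc N"] by simp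
  then have "ip (e (r N) - e (r (Suc N))) (e (r N) - e (r (Suc N))) = 2"
    by (simp add: inner.expand_diff e_in_D al e_orthonormal)
  then show False using N[of N "Suc N"] by simp
qed

lemma not_all_alive:
  assumes "alive \<noteq> UNIV"
  obtains N where "{..<N} = alive" "perp (e ` {..<N}) \<subseteq> {0}"
proof -
  define N where "N = (LEAST n. n \<notin> alive)"
  have N: "N \<notin> alive" unfolding N_def using assms LeastI_ex[of "\<lambda>n. n \<notin> alive"] by auto
  have "{..<N} = alive"
  proof
    show "{..<N} \<subseteq> alive" unfolding N_def using not_less_Least by auto
    show "alive \<subseteq> {..<N}" using alive_downward N by (meson lessThan_iff not_le subsetI)
  qed
  moreover have "perp (e ` {..<N}) \<subseteq> {0}" using N by (auto simp: alive_def)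
  ultimately show ?thesis using that by blast
qed

text \<open>If the sequence never stops, a nonzero \<open>v\<close> orthogonal to all
  \<open>e n\<close> competes at every stage, so its Rayleigh quotient bounds all
  \<open>lam n\<close>, contrary to \<open>finite_lam_le\<close>.\<close>

lemma e_complete:
  assumes v: "v \<in> D" "\<And>n. n \<in> alive \<Longrightarrow> ip v (e n) = 0"
  shows "v = 0"
proof (cases "alive = UNIV")
  case False
  then obtain N where "{..<N} = alive" "perp (e ` {..<N}) \<subseteq> {0}" by (rule not_all_alive)
  then show ?thesis using v by (auto simp: perp_def)
next
  case True
  show ?thesis
  proof (rule ccontr)
    assume "v \<noteq> 0"
    then have pos: "0 < ip v v" using definite[OF v(1)] inner.nonneg[OF v(1)] by fastforce
    have "lam n \<le> Q v v / ip v v" for n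
      using lam_minimal[of n v] v True pos by (simp add: field_simps)
    then show False using finite_lam_le[of "Q v v / ip v v"] True by simp
  qed
qed

text \<open>The greedy choice finds each eigenvalue with full multiplicity. Subtract from an
  eigenvector its projection onto the span: the rest is orthogonal to the chosen \<open>e n\<close>
  by projection and to the others because their eigenvalues differ, so it is zero by
  completeness.\<close>

lemma weak_eigenspace_eq_span: "weak_eigenspace t = span (e ` {n \<in> alive. lam n = t})"
proof
  let ?F = "{n \<in> alive. lam n = t}"
  have fin: "finite ?F" by (rule finite_subset[OF _ finite_lam_le[of t]]) auto
  have on: "orthonormal (e ` ?F)" by (rule orthonormal_image) auto
  have sub: "e ` ?F \<subseteq> weak_eigenspace t" using e_eigenvector by auto
  then show "span (e ` ?F) \<subseteq> weak_eigenspace t"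
    by (rule span_minimal[OF _ subspace_weak_eigenspace])
  show "weak_eigenspace t \<subseteq> span (e ` ?F)"
  proof
    fix f assume f: "f \<in> weak_eigenspace t"
    then have fD: "f \<in> D" using weak_eigenspace_subset by auto
    define p where "p = (\<Sum>s\<in>e ` ?F. scl (ip f s) s)"
    have pspan: "p \<in> span (e ` ?F)"
      unfolding p_def by (intro span_sum span_scale span_base)
    have "p \<in> weak_eigenspace t"
      unfolding p_def
      by (intro subspace_sum[OF subspace_weak_eigenspace] subspace_scale[OF subspace_weak_eigenspace])
        (use sub in auto)
    then have g: "f - p \<in> weak_eigenspace t"
      using f subspace_diff[OF subspace_weak_eigenspace] by blast
    have "f - p = 0"
    proof (rule e_complete)
      show "f - p \<in> D" using g weak_eigenspace_subset by auto
      fix n assume n: "n \<in> alive"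
      show "ip (f - p) (e n) = 0"
      proof (cases "lam n = t")
        case True
        then show ?thesis
          using project_perp[OF _ on fD] fin n by (simp add: p_def perp_def)
      next
        case False
        then show ?thesis
          using weak_eigenspaces_orthogonal[OF g e_eigenvector[OF n]] by auto
      qed
    qed
    then show "f \<in> span (e ` ?F)" using pspan by simp
  qed
qed

text \<open>The right-hand side mentions neither the sequence nor the form, so greedy sequences of
  two forms on the same \<open>D\<close> share their index set.\<close>

lemma alive_iff_independent:
  "n \<in> alive \<longleftrightarrow> (\<exists>B. B \<subseteq> D \<and> independent B \<and> finite B \<and> card B = Suc n)"
proof
  assume n: "n \<in> alive"
  have sub: "{..n} \<subseteq> alive" using alive_downward[OF n] by auto
  show "\<exists>B. B \<subseteq> D \<and> independent B \<and> finite B \<and> card B = Suc n"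
  proof (intro exI conjI)
    show "e ` {..n} \<subseteq> D" using sub e_in_D by auto
    show "independent (e ` {..n})" by (rule orthonormal_independent[OF orthonormal_image[OF sub]])
    show "card (e ` {..n}) = Suc n" using card_image[OF inj_on_subset[OF inj_on_e sub]] by simp
  qed simp
next
  assume "\<exists>B. B \<subseteq> D \<and> independent B \<and> finite B \<and> card B = Suc n"
  then obtain B where B: "B \<subseteq> D" "independent B" "card B = Suc n" by blast
  show "n \<in> alive"
  proof (rule ccontr)
    assume n: "n \<notin> alive"
    then obtain N where N: "{..<N} = alive" "perp (e ` {..<N}) \<subseteq> {0}"
      using not_all_alive by auto
    \<comment> \<open>The choice stopped at \<open>N\<close>, so the residue of any \<open>v\<close>
      after projection lies in a trivial complement: the first \<open>N\<close> vectors span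
      \<open>D\<close>.\<close>
    have "v \<in> span (e ` {..<N})" if v: "v \<in> D" for v
    proof -
      define p where "p = (\<Sum>s\<in>e ` {..<N}. scl (ip v s) s)"
      have "v - p \<in> perp (e ` {..<N})"
        unfolding p_def by (rule project_perp[OF _ orthonormal_image[OF equalityD1[OF N(1)]] v]) simp
      then have "v = p" using N(2) by auto
      moreover have "p \<in> span (e ` {..<N})"
        unfolding p_def by (intro span_sum span_scale span_base)
      ultimately show ?thesis by simp
    qed
    then have "card B \<le> card (e ` {..<N})"
      using independent_span_bound[of "e ` {..<N}" B] B by auto
    also have "\<dots> \<le> N" using card_image_le[of "{..<N}" e] by simp
    also have "\<dots> \<le> n" using n unfolding N(1)[symmetric] by simp
    finally show False using B(3) by simp
  qed
qed

lemma finite_lam_eq: "finite {n \<in> alive. lam n = t}"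
  by (rule finite_subset[OF _ finite_lam_le[of t]]) auto

lemma independent_image: "F \<subseteq> alive \<Longrightarrow> independent (e ` F)"
  by (intro orthonormal_independent orthonormal_image)

lemma card_image_e: "F \<subseteq> alive \<Longrightarrow> card (e ` F) = card F"
  by (rule card_image[OF inj_on_subset[OF inj_on_e]])

end

section \<open>Comparison of two forms with the same eigenvalues\<close>

lemma (in vector_space) independent_card_eq_span_eq:
  assumes "independent S" "S \<subseteq> span T" "finite T" "card S = card T"
  shows "span S = span T"
proof
  show "span S \<subseteq> span T" using assms(2) by (simp add: span_minimal subspace_span)
  have "T \<subseteq> span S"
  proof (rule ccontr)
    assume "\<not> T \<subseteq> span S"
    then obtain x where x: "x \<in> T" "x \<notin> span S" by blast
    have "independent (insert x S)" using x assms(1) by (intro independent_insertI) auto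
    moreover have "insert x S \<subseteq> span T" using x assms(2) span_base by auto
    ultimately have "card (insert x S) \<le> card T" "finite S"
      using independent_span_bound[OF assms(3), of "insert x S"] by auto
    moreover have "x \<notin> S" using x span_base by blast
    ultimately show False using assms(4) by simp
  qed
  then show "span T \<subseteq> span S" by (simp add: span_minimal subspace_span)
qed

text \<open>A lowest eigenvector of the larger form minimizes the smaller one as well; since the
  multiplicities agree, the eigenspaces can be split off one after the other.\<close>

lemma isospectral_forms_agree:
  assumes "greedy_sequence scl D ip Q e" "greedy_sequence scl D ip Q' e'"
    and le: "\<And>v. v \<in> D \<Longrightarrow> Q v v \<le> Q' v v"
    and eq: "\<And>n. n \<in> greedy_sequence.alive D ip e \<Longrightarrow>
      greedy_sequence.lam Q' e' n = greedy_sequence.lam Q e n"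
    and n: "n \<in> greedy_sequence.alive D ip e"
  shows "Q' (e n) (e n) = Q (e n) (e n)"
proof -
  interpret A: greedy_sequence scl D ip Q e by fact
  interpret B: greedy_sequence scl D ip Q' e' by fact
  have alive: "B.alive = A.alive"
    by (rule set_eqI) (simp only: A.alive_iff_independent B.alive_iff_independent)
  have "B.weak_eigenspace (A.lam n) = A.weak_eigenspace (A.lam n)" if "n \<in> A.alive" for n
    using that
  proof (induction n rule: less_induct)
    case (less n)
    define t where "t = A.lam n"
    \<comment> \<open>The first occurrence of \<open>t\<close>: all eigenvalues before
      \<open>n0\<close> differ from \<open>t\<close>, and the induction hypothesis covers them. The
      \<open>LEAST\<close> ranges over all naturals, but \<open>n0 \<le> n\<close> puts
      \<open>n0\<close> into \<open>alive\<close>.\<close>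
    define n0 where "n0 = (LEAST k. A.lam k = t)"
    have n0: "A.lam n0 = t" "n0 \<le> n"
      unfolding n0_def by (auto simp: t_def intro: LeastI Least_le)
    have n0_alive: "n0 \<in> A.alive" using A.alive_downward less.prems n0 by blast
    have sub: "B.weak_eigenspace t \<subseteq> A.weak_eigenspace t"
    proof
      fix f assume f: "f \<in> B.weak_eigenspace t"
      then have fD: "f \<in> D" using B.weak_eigenspace_subset by auto
      \<comment> \<open>By induction \<open>e k\<close> is also an eigenvector of \<open>Q'\<close>,
        with an eigenvalue other than \<open>t\<close>.\<close>
      have "ip f (e k) = 0" if k: "k < n0" for k
      proof (rule B.weak_eigenspaces_orthogonal[OF f])
        have k_alive: "k \<in> A.alive" using A.alive_downward n0_alive k by (meson less_imp_le)
        then show "e k \<in> B.weak_eigenspace (A.lam k)"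
          using less.IH[of k] A.e_eigenvector k n0 by simp
        show "t \<noteq> A.lam k" using k not_less_Least n0_def by metis
      qed
      then have fperp: "f \<in> A.perp (e ` {..<n0})" using fD by (auto simp: A.perp_def)
      have min: "t * ip v v \<le> Q v v" if "v \<in> A.perp (e ` {..<n0})" for v
        using A.lam_minimal[OF n0_alive, of v] that n0 by (auto simp: A.perp_def)
      \<comment> \<open>Squeezed:
        \<open>t * ip f f \<le> Q f f \<le> Q' f f = t * ip f f\<close>.\<close>
      have "Q f f = t * ip f f"
        using le[OF fD] min[OF fperp] B.weak_eigenspaceD[OF f fD] by simp
      then show "f \<in> A.weak_eigenspace t"
        using A.minimizer_is_eigenvector[OF _ A.orthonormal_image[OF A.below_alive[OF n0_alive]]
            _ fperp _ min] A.e_eigenvector A.below_alive[OF n0_alive]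
        by blast
    qed
    let ?F = "{n \<in> A.alive. A.lam n = t}"
    have F: "{n \<in> B.alive. B.lam n = t} = ?F" using alive eq by auto
    \<comment> \<open>The inclusion \<open>sub\<close> becomes an equality by counting: both
      eigenspaces have bases indexed by the same finite set \<open>?F\<close>.\<close>
    have "A.span (e' ` ?F) = A.span (e ` ?F)"
    proof (rule A.independent_card_eq_span_eq)
      show "A.independent (e' ` ?F)" using B.independent_image[of ?F] alive by auto
      show "e' ` ?F \<subseteq> A.span (e ` ?F)"
        using A.span_superset[of "e' ` ?F"] sub
        unfolding A.weak_eigenspace_eq_span B.weak_eigenspace_eq_span F by (rule order_trans)
      show "finite (e ` ?F)" using A.finite_lam_eq by simp
      show "card (e' ` ?F) = card (e ` ?F)"
        using A.card_image_e[of ?F] B.card_image_e[of ?F] alive by auto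
    qed
    then show ?case
      unfolding t_def[symmetric] A.weak_eigenspace_eq_span B.weak_eigenspace_eq_span F .
  qed
  then have "e n \<in> B.weak_eigenspace (A.lam n)" "e n \<in> A.weak_eigenspace (A.lam n)"
    using A.e_eigenvector n by auto
  then show ?thesis
    using A.weak_eigenspaceD B.weak_eigenspaceD A.e_in_D[OF n] by metis
qed


section \<open>Weighted square-summable functions\<close>

text \<open>The index type is arbitrary so that one theory serves functions on vertices, with
  weights \<open>m\<close> and \<open>c\<close>, and functions on pairs of vertices, with weight
  \<open>b / 2\<close>.\<close>

definition sq_summable :: "('i \<Rightarrow> real) \<Rightarrow> ('i \<Rightarrow> real) set" where
  "sq_summable w = {f. (\<lambda>x. w x * (f x)\<^sup>2) summable_on UNIV}"

definition weighted_form :: "('i \<Rightarrow> real) \<Rightarrow> ('i \<Rightarrow> real) \<Rightarrow> ('i \<Rightarrow> real) \<Rightarrow> real" where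
  "weighted_form w f g = (\<Sum>\<^sub>\<infinity>x. w x * f x * g x)"

lemma sq_summable_mult:
  assumes w: "\<And>x. 0 \<le> w x" and "f \<in> sq_summable w" "g \<in> sq_summable w"
  shows "(\<lambda>x. w x * f x * g x) summable_on UNIV"
proof -
  have "(\<lambda>x. norm (w x * f x * g x)) summable_on UNIV"
  proof (rule summable_on_comparison_test)
    show "(\<lambda>x. w x * (f x)\<^sup>2 + w x * (g x)\<^sup>2) summable_on UNIV"
      using assms by (intro summable_on_add) (auto simp: sq_summable_def)
    fix x
    have "\<bar>f x * g x\<bar> \<le> (f x)\<^sup>2 + (g x)\<^sup>2"
    proof -
      have "0 \<le> (\<bar>f x\<bar> - \<bar>g x\<bar>)\<^sup>2" by simp
      then have "2 * \<bar>f x * g x\<bar> \<le> (f x)\<^sup>2 + (g x)\<^sup>2"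
        by (simp add: power2_diff abs_mult)
      then show ?thesis by simp
    qed
    then show "norm (w x * f x * g x) \<le> w x * (f x)\<^sup>2 + w x * (g x)\<^sup>2"
      using mult_left_mono[OF _ w[of x]] w[of x]
      by (simp add: abs_mult mult.assoc flip: distrib_left)
  qed simp
  then show ?thesis by (rule abs_summable_summable)
qed

lemma subspace_sq_summable:
  assumes w: "\<And>x. 0 \<le> w x"
  shows "fun_space.subspace (sq_summable w)"
proof (rule fun_space.subspaceI)
  show "0 \<in> sq_summable w" by (simp add: sq_summable_def zero_fun_def)
next
  fix f g assume fg: "f \<in> sq_summable w" "g \<in> sq_summable w"
  have "(\<lambda>x. w x * (f x)\<^sup>2 + 2 * (w x * f x * g x) + w x * (g x)\<^sup>2) summable_on UNIV"
    using fg by (intro summable_on_add summable_on_cmult_right sq_summable_mult[OF w])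
      (auto simp: sq_summable_def)
  then show "f + g \<in> sq_summable w"
    by (simp add: sq_summable_def plus_fun_def power2_sum algebra_simps)
next
  fix r f assume "f \<in> sq_summable w"
  then show "fun_scale r f \<in> sq_summable w"
    using summable_on_cmult_right[of "\<lambda>x. w x * (f x)\<^sup>2" UNIV "r\<^sup>2"]
    by (simp add: sq_summable_def fun_scale_def power_mult_distrib algebra_simps)
qed

lemma weighted_form_nonneg: "(\<And>x. 0 \<le> w x) \<Longrightarrow> 0 \<le> weighted_form w f f"
  unfolding weighted_form_def by (intro infsum_nonneg) (simp add: mult.assoc)

text \<open>Pullback of a weighted inner product along a linear map \<open>T\<close>: the identity
  for \<open>m\<close> and \<open>c\<close>, and \<open>edge_diff\<close> for the energy.\<close>

lemma psd_form_weighted: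
  assumes w: "\<And>x. 0 \<le> w x"
    and T: "\<And>f g. T (f + g) = T f + T g" "\<And>r f. T (fun_scale r f) = fun_scale r (T f)"
    and D: "fun_space.subspace D" "T ` D \<subseteq> sq_summable w"
  shows "psd_form fun_scale D (\<lambda>f g. weighted_form w (T f) (T g))"
proof unfold_locales
  have sm: "(\<lambda>x. w x * T f x * T g x) summable_on UNIV" if "f \<in> D" "g \<in> D" for f g
    using that D(2) by (intro sq_summable_mult[OF w]) auto
  fix f g h assume f: "f \<in> D" and g: "g \<in> D"
  show "weighted_form w (T f) (T g) = weighted_form w (T g) (T f)"
    by (simp add: weighted_form_def mult.commute mult.left_commute)
  show "weighted_form w (T (f + g)) (T h) = weighted_form w (T f) (T h) + weighted_form w (T g) (T h)"
    if h: "h \<in> D"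
    using infsum_add[OF sm[OF f h] sm[OF g h]]
    by (simp add: weighted_form_def T(1) algebra_simps)
  show "weighted_form w (T (fun_scale r f)) (T g) = r * weighted_form w (T f) (T g)" for r
    unfolding weighted_form_def T(2) infsum_cmult_right'[symmetric]
    by (simp add: fun_scale_def mult.assoc mult.left_commute)
  show "0 \<le> weighted_form w (T f) (T f)"
    by (rule weighted_form_nonneg[OF w])
qed (fact D(1))


section \<open>The forms of a graph\<close>

definition edge_diff :: "('a \<Rightarrow> real) \<Rightarrow> 'a \<times> 'a \<Rightarrow> real" where
  "edge_diff f = (\<lambda>(x, y). f x - f y)"

lemma ell2_eq: "ell2 m = sq_summable m"
  by (simp add: ell2_def sq_summable_def mult.commute)

lemma ell2_inner_eq: "ell2_inner m = weighted_form m"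
  by (simp add: ell2_inner_def weighted_form_def fun_eq_iff mult.commute mult.left_commute)

lemma energy_form_split: "energy_form b c f g = energy_form b (\<lambda>_. 0) f g + weighted_form c f g"
  by (simp add: energy_form_def weighted_form_def)

lemma energy_form_0_eq:
  "energy_form b (\<lambda>_. 0) f g = weighted_form (\<lambda>(x, y). b x y / 2) (edge_diff f) (edge_diff g)"
  unfolding energy_form_def weighted_form_def infsum_cmult_right'[symmetric]
  by (auto simp: edge_diff_def intro!: infsum_cong)

lemma psd_form_ell2_inner:
  assumes "\<And>x. 0 \<le> m x" "fun_space.subspace D" "D \<subseteq> ell2 m"
  shows "psd_form fun_scale D (ell2_inner m)"
  using psd_form_weighted[of m "\<lambda>f. f" D] assms by (simp add: ell2_eq ell2_inner_eq)

lemma psd_form_energy: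
  assumes b: "\<And>x y. 0 \<le> b x y" and D: "fun_space.subspace D" "D \<subseteq> energy_space b (\<lambda>_. 0)"
  shows "psd_form fun_scale D (energy_form b (\<lambda>_. 0))"
proof -
  have "edge_diff f \<in> sq_summable (\<lambda>(x, y). b x y / 2)" if "f \<in> D" for f
  proof -
    have "(\<lambda>(x, y). b x y * \<bar>f x - f y\<bar>\<^sup>2) summable_on UNIV"
      using that D(2) by (auto simp: energy_space_def)
    from summable_on_cmult_right[OF this, of "1 / 2"] show ?thesis
      by (simp add: sq_summable_def edge_diff_def case_prod_unfold)
  qed
  then have "psd_form fun_scale D
      (\<lambda>f g. weighted_form (\<lambda>(x, y). b x y / 2) (edge_diff f) (edge_diff g))"
    using D(1) b
    by (intro psd_form_weighted)
      (auto simp: edge_diff_def fun_eq_iff fun_scale_def algebra_simps)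
  moreover have "energy_form b (\<lambda>_. 0) =
      (\<lambda>f g. weighted_form (\<lambda>(x, y). b x y / 2) (edge_diff f) (edge_diff g))"
    by (intro ext) (rule energy_form_0_eq)
  ultimately show ?thesis by (simp only:)
qed

lemma ell2_inner_definite:
  assumes m: "\<And>x. 0 < m x" and f: "f \<in> ell2 m" "ell2_inner m f f = 0"
  shows "f = 0"
proof
  fix x
  have "(\<Sum>x\<in>{x}. m x * f x * f x) \<le> (\<Sum>\<^sub>\<infinity>x. m x * f x * f x)"
    using f(1) m
    by (intro finite_sum_le_infsum sq_summable_mult) (auto simp: ell2_eq less_imp_le mult.assoc)
  then have "m x * (f x * f x) \<le> 0"
    using f(2) by (simp add: ell2_inner_eq weighted_form_def mult.assoc)
  then have "f x * f x \<le> 0"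
    using m[of x] by (simp add: mult_le_0_iff)
  then show "f x = 0 x"
    by (metis mult_eq_0_iff order_antisym zero_le_square zero_fun_apply)
qed

lemma Metric_space_ell2:
  assumes m: "\<And>x. 0 < m x"
  shows "Metric_space (ell2 m) (\<lambda>f g. ell2_norm m (f - g))"
  unfolding ell2_norm_def
proof (rule Metric_space_form[where B = "ell2_inner m" and scl = fun_scale])
  show "psd_form fun_scale (ell2 m) (ell2_inner m)"
    using subspace_sq_summable[of m] m
    by (intro psd_form_ell2_inner) (auto simp: less_imp_le ell2_eq)
  show "0 \<le> ell2_inner m u u" for u
    unfolding ell2_inner_eq by (rule weighted_form_nonneg) (simp add: m less_imp_le)
  show "ell2_inner m (u - v) (u - v) = ell2_inner m (v - u) (v - u)" for u v
    unfolding ell2_inner_def by (intro infsum_cong) (simp add: algebra_simps)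
qed (rule ell2_inner_definite[OF m])

text \<open>Translates the topological hypotheses, relative compactness of the form unit ball and
  metric completeness, into the sequential assumptions of \<open>compact_form\<close>.\<close>

lemma realization_compact_form:
  assumes graph: "graph_over b (\<lambda>_. 0) m" and real: "realization_form b m D"
    and emb: "compactly_embedded m (energy_form b (\<lambda>_. 0)) D"
  shows "compact_form fun_scale D (ell2_inner m) (energy_form b (\<lambda>_. 0))"
proof -
  define Q where "Q = energy_form b (\<lambda>_. 0)"
  have b: "\<And>x y. 0 \<le> b x y" and m: "\<And>x. 0 < m x"
    using graph by (auto simp: graph_over_def)
  have D: "fun_space.subspace D" "D \<subseteq> ell2 m" "D \<subseteq> energy_space b (\<lambda>_. 0)"
    and closed: "closed_form m Q D"
    using real by (auto simp: realization_form_def Q_def)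
  interpret I: psd_form fun_scale D "ell2_inner m"
    by (rule psd_form_ell2_inner[OF _ D(1,2)]) (simp add: m less_imp_le)
  interpret Q: psd_form fun_scale D Q
    unfolding Q_def by (rule psd_form_energy[OF b D(1,3)])
  have I0: "0 \<le> ell2_inner m u u" for u
    unfolding ell2_inner_eq by (rule weighted_form_nonneg) (simp add: m less_imp_le)
  have Q0: "0 \<le> Q u u" for u
    unfolding Q_def energy_form_0_eq by (rule weighted_form_nonneg) (auto simp: b)
  have Iminus: "ell2_inner m (u - v) (u - v) = ell2_inner m (v - u) (v - u)" for u v
    unfolding ell2_inner_def by (intro infsum_cong) (simp add: algebra_simps)
  have Qminus: "Q (u - v) (u - v) = Q (v - u) (v - u)" for u v
    unfolding Q_def energy_form_def
    by (auto intro!: infsum_cong simp: algebra_simps)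
  have definite: "u = 0" if "u \<in> D" "ell2_inner m u u = 0" for u
    by (rule ell2_inner_definite[of m]) (use m that D(2) in auto)
  have norm: "form_norm m Q u = sqrt (ell2_inner m u u + Q u u)" for u
    by (simp add: form_norm_def ell2_norm_def I0)
  interpret M: Metric_space D "\<lambda>u v. form_norm m Q (u - v)"
    unfolding norm
    by (rule Metric_space_form[where B = "\<lambda>u v. ell2_inner m u v + Q u v",
          OF psd_form_add[OF I.psd_form_axioms Q.psd_form_axioms]])
      (use I0 Q0 definite in \<open>auto simp: Iminus Qminus add_nonneg_eq_0_iff\<close>)
  interpret H: Metric_space "ell2 m" "\<lambda>f g. ell2_norm m (f - g)"
    by (rule Metric_space_ell2[OF m])
  have "compact_form fun_scale D (ell2_inner m) Q"
  proof
    fix u :: "nat \<Rightarrow> 'a \<Rightarrow> real" and C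
    assume u: "\<And>k. u k \<in> D" and le: "\<And>k. ell2_inner m (u k) (u k) + Q (u k) (u k) \<le> C"
    \<comment> \<open>A positive bound, so that division by \<open>sqrt C'\<close> moves the
      sequence into the unit ball.\<close>
    define C' where "C' = max C 1"
    have C': "C' > 0" by (simp add: C'_def)
    define v where "v k = fun_scale (1 / sqrt C') (u k)" for k
    let ?S = "{f \<in> D. form_norm m Q f \<le> 1}"
    have "v k \<in> ?S" for k
    proof -
      have "ell2_inner m (v k) (v k) + Q (v k) (v k) =
          (ell2_inner m (u k) (u k) + Q (u k) (u k)) / C'"
        using C' u by (simp add: v_def I.expand_scale Q.expand_scale power_divide add_divide_distrib)
      also have "\<dots> \<le> 1" using le[of k] C' by (simp add: C'_def)
      finally show ?thesis using u by (simp add: norm v_def I.mem_closed)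
    qed
    moreover have "?S \<subseteq> ell2_topology m closure_of ?S"
      by (rule closure_of_subset) (use D(2) in \<open>auto simp: ell2_topology_def\<close>)
    ultimately have "range v \<subseteq> ell2_topology m closure_of ?S" by auto
    moreover have "compactin H.mtopology (ell2_topology m closure_of ?S)"
      using emb by (simp add: compactly_embedded_def ell2_topology_def Q_def)
    ultimately obtain l and r :: "nat \<Rightarrow> nat" where r: "strict_mono r"
      and "limitin H.mtopology (v \<circ> r) l sequentially"
      unfolding H.compactin_sequentially by meson
    \<comment> \<open>The limit \<open>l\<close> is a point of \<open>ell2 m\<close> and may lie
      outside \<open>D\<close>; what is kept is the Cauchy property.\<close>
    then have "H.MCauchy (v \<circ> r)"
      using D(2) u by (intro H.convergent_imp_MCauchy) (auto simp: v_def I.mem_closed subset_iff)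
    then have cau: "\<exists>N. \<forall>i\<ge>N. \<forall>j\<ge>N. ell2_norm m (v (r i) - v (r j)) < \<delta>" if "\<delta> > 0" for \<delta>
      using that unfolding H.MCauchy_def by (metis comp_apply)
    have "\<exists>N. \<forall>i\<ge>N. \<forall>j\<ge>N. ell2_inner m (u (r i) - u (r j)) (u (r i) - u (r j)) < \<epsilon>"
      if \<epsilon>: "\<epsilon> > 0" for \<epsilon>
    proof -
      obtain N where N: "\<forall>i\<ge>N. \<forall>j\<ge>N. ell2_norm m (v (r i) - v (r j)) < sqrt (\<epsilon> / C')"
        using cau[of "sqrt (\<epsilon> / C')"] \<epsilon> C' by auto
      have "ell2_inner m (u (r i) - u (r j)) (u (r i) - u (r j)) < \<epsilon>" if "i \<ge> N" "j \<ge> N" for i j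
      proof -
        have "v (r i) - v (r j) = fun_scale (1 / sqrt C') (u (r i) - u (r j))"
          by (simp add: v_def fun_space.scale_right_diff_distrib)
        then have "ell2_inner m (v (r i) - v (r j)) (v (r i) - v (r j)) =
            ell2_inner m (u (r i) - u (r j)) (u (r i) - u (r j)) / C'"
          using C' u by (simp add: I.expand_scale I.mem_closed power_divide)
        moreover have "ell2_inner m (v (r i) - v (r j)) (v (r i) - v (r j)) < \<epsilon> / C'"
          using N that by (simp add: ell2_norm_def)
        ultimately show ?thesis using C' by (simp add: divide_less_cancel)
      qed
      then show ?thesis by blast
    qed
    then show "\<exists>r :: nat \<Rightarrow> nat. strict_mono r \<and> (\<forall>\<epsilon>>0. \<exists>N. \<forall>i\<ge>N. \<forall>j\<ge>N.
        ell2_inner m (u (r i) - u (r j)) (u (r i) - u (r j)) < \<epsilon>)"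
      using r by blast
  next
    fix u :: "nat \<Rightarrow> 'a \<Rightarrow> real"
    assume u: "\<And>k. u k \<in> D" and cau: "\<forall>\<epsilon>>0. \<exists>N. \<forall>i\<ge>N. \<forall>j\<ge>N.
        ell2_inner m (u i - u j) (u i - u j) + Q (u i - u j) (u i - u j) < \<epsilon>"
    have "M.MCauchy u"
      unfolding M.MCauchy_def
    proof (intro conjI allI impI)
      fix \<epsilon> :: real assume \<epsilon>: "\<epsilon> > 0"
      then obtain N where N: "\<forall>i\<ge>N. \<forall>j\<ge>N.
          ell2_inner m (u i - u j) (u i - u j) + Q (u i - u j) (u i - u j) < \<epsilon>\<^sup>2"
        using cau by (meson zero_less_power)
      then show "\<exists>N. \<forall>i j. N \<le> i \<longrightarrow> N \<le> j \<longrightarrow> form_norm m Q (u i - u j) < \<epsilon>"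
        unfolding norm using \<epsilon> by (meson real_less_lsqrt less_imp_le)
    qed (use u in auto)
    then obtain l where "limitin M.mtopology u l sequentially"
      using closed unfolding closed_form_def M.mcomplete_def by blast
    then have l: "l \<in> D" and lim: "(\<lambda>k. form_norm m Q (u k - l)) \<longlonglongrightarrow> 0"
      unfolding M.limitin_metric_dist_null by auto
    have "(\<lambda>k. (form_norm m Q (u k - l))\<^sup>2) \<longlonglongrightarrow> 0"
      using tendsto_power[OF lim, of 2] by simp
    then show "\<exists>l\<in>D. (\<lambda>k. ell2_inner m (u k - l) (u k - l) + Q (u k - l) (u k - l)) \<longlonglongrightarrow> 0"
      using l by (intro bexI[of _ l]) (simp_all add: norm I0 Q0)
  qed (rule definite)
  then show ?thesis by (simp add: Q_def)
qed


section \<open>Eigenvalue listings\<close>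

text \<open>The substantial inclusion is from right to left: a weak eigenvector lies in the domain
  of the adjoint, and self-adjointness puts it into \<open>DL\<close>.\<close>

lemma eigenspace_eq_weak_eigenspace:
  assumes ao: "associated_operator m Q D DL L" and D: "D \<subseteq> ell2 m" "fun_space.subspace D"
    and cf: "compact_form fun_scale D (ell2_inner m) Q"
  shows "eigenspace DL L t = compact_form.weak_eigenspace D (ell2_inner m) Q t"
proof -
  interpret compact_form fun_scale D "ell2_inner m" Q by fact
  have DL: "DL \<subseteq> D" and Q: "\<And>f g. f \<in> D \<Longrightarrow> g \<in> DL \<Longrightarrow> Q f g = ell2_inner m f (L g)"
    and adj: "adjoint_graph m DL L = {(g, L g) | g. g \<in> DL}"
    using ao by (auto simp: associated_operator_def self_adjoint_def)
  have comm: "ell2_inner m f g = ell2_inner m g f" for f g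
    by (simp add: ell2_inner_def mult.commute)
  have scale: "ell2_inner m f (fun_scale t g) = t * ell2_inner m f g" for f g
    unfolding ell2_inner_def infsum_cmult_right'[symmetric]
    by (simp add: fun_scale_def mult_ac)
  show ?thesis
  proof (intro equalityI subsetI)
    fix f assume f: "f \<in> eigenspace DL L t"
    then have fDL: "f \<in> DL" and Lf: "L f = fun_scale t f" by (auto simp: eigenspace_def)
    have "Q f v = t * ell2_inner m f v" if "v \<in> D" for v
      using form.sym[of f v] Q[OF that fDL] Lf scale comm that fDL DL by auto
    then show "f \<in> weak_eigenspace t" using fDL DL by (auto simp: weak_eigenspace_def)
  next
    fix f assume f: "f \<in> weak_eigenspace t"
    then have fD: "f \<in> D" by (simp add: weak_eigenspace_def)
    have "(f, fun_scale t f) \<in> adjoint_graph m DL L"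
      unfolding adjoint_graph_def
    proof (clarify, intro conjI ballI)
      show "f \<in> ell2 m" "fun_scale t f \<in> ell2 m" using fD D form.mem_closed(4) by auto
      fix g assume g: "g \<in> DL"
      have "ell2_inner m (L g) f = Q f g" using Q[OF fD g] comm by simp
      also have "\<dots> = t * ell2_inner m f g" using weak_eigenspaceD[OF f] g DL by auto
      finally show "ell2_inner m (L g) f = ell2_inner m g (fun_scale t f)"
        using scale comm by simp
    qed
    then show "f \<in> eigenspace DL L t" using adj by (auto simp: eigenspace_def)
  qed
qed

text \<open>At the first disagreement, say \<open>p n < q n\<close>, monotonicity confines the
  occurrences of \<open>p n\<close> in \<open>q\<close> to indices below \<open>n\<close>. There
  \<open>p\<close> agrees with \<open>q\<close>, and \<open>p\<close> takes the value once more at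
  \<open>n\<close>, so the two multiplicities of this eigenvalue differ.\<close>

lemma eigenvalue_listing_unique:
  assumes "eigenvalue_listing m DL L lam" "eigenvalue_listing m DL L lam'"
    and "n \<in> eigen_indices m"
  shows "lam n = lam' n"
proof -
  let ?I = "eigen_indices m"
  have False
    if l: "eigenvalue_listing m DL L p" "eigenvalue_listing m DL L q"
      and n: "n \<in> ?I" "p n < q n" and eq: "\<And>k. k < n \<Longrightarrow> k \<in> ?I \<Longrightarrow> p k = q k" for p q n
  proof -
    obtain B h where B: "fun_space.independent B" "fun_space.span B = eigenspace DL L (p n)"
        "bij_betw h {k \<in> ?I. p k = p n} B"
      using l(1) unfolding eigenvalue_listing_def by blast
    obtain B' h' where B': "fun_space.independent B'" "fun_space.span B' = eigenspace DL L (p n)"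
        "bij_betw h' {k \<in> ?I. q k = p n} B'"
      using l(2) unfolding eigenvalue_listing_def by blast
    obtain f where "bij_betw f B B'"
      using fun_space.bij_if_span_eq_span_bases[OF B(1) B'(1)] B(2) B'(2) by auto
    then have same: "card B = card B'" "finite B = finite B'"
      using bij_betw_same_card bij_betw_finite by blast+
    have "k < n" if "k \<in> ?I" "q k = p n" for k
    proof (rule ccontr)
      assume "\<not> k < n"
      then have "q n \<le> q k"
        using l(2) mono_onD[OF _ n(1) that(1)] by (auto simp: eigenvalue_listing_def)
      then show False using that n by simp
    qed
    then have sub: "insert n {k \<in> ?I. q k = p n} \<subseteq> {k \<in> ?I. p k = p n}"
      and fin': "finite {k \<in> ?I. q k = p n}"
      using eq n by (auto intro: finite_subset[of _ "{..<n}"])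
    then have fin: "finite {k \<in> ?I. p k = p n}"
      using same bij_betw_finite[OF B(3)] bij_betw_finite[OF B'(3)] by simp
    have "Suc (card {k \<in> ?I. q k = p n}) \<le> card {k \<in> ?I. p k = p n}"
      using card_mono[OF fin sub] fin' n by simp
    then show False
      using same bij_betw_same_card[OF B(3)] bij_betw_same_card[OF B'(3)] by simp
  qed
  note * = this
  show ?thesis
    using assms(3)
  proof (induction n rule: less_induct)
    case (less n)
    show ?case
      using *[OF assms(1,2) less.prems] *[OF assms(2,1) less.prems] less.IH
      by (metis linorder_neqE_linordered_idom)
  qed
qed

lemma nth_eigenvalue_eq:
  assumes "eigenvalue_listing m DL L lam" "n \<in> eigen_indices m"
  shows "nth_eigenvalue m DL L n = lam n"
  unfolding nth_eigenvalue_def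
  using assms eigenvalue_listing_unique by (intro the_equality) blast+

lemma independent_deltas:
  assumes "finite F"
  shows "fun_space.independent ((\<lambda>x. indicator {x} :: 'a \<Rightarrow> real) ` F)"
  using assms
proof (induction F)
  case empty
  then show ?case by (simp add: fun_space.independent_empty)
next
  case (insert x F)
  have "fun_space.span ((\<lambda>x. indicator {x}) ` F) \<subseteq> {f :: 'a \<Rightarrow> real. f x = 0}"
  proof (rule fun_space.span_minimal)
    show "fun_space.subspace {f :: 'a \<Rightarrow> real. f x = 0}"
      by (rule fun_space.subspaceI) (auto simp: fun_scale_def)
  qed (use insert.hyps in \<open>auto simp: indicator_def\<close>)
  then have "(indicator {x} :: 'a \<Rightarrow> real) \<notin> fun_space.span ((\<lambda>x. indicator {x}) ` F)"
    by auto
  then show ?case using fun_space.independent_insertI[OF _ insert.IH] by simp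
qed

lemma indicator_in_fin_supp_funs: "indicator {x} \<in> fin_supp_funs"
  by (auto simp: fin_supp_funs_def indicator_def intro: finite_subset[of _ "{x}"])

text \<open>Dimensions can be counted in the form domain. For finite \<open>X\<close> it is all of
  \<open>ell2 m\<close>; for infinite \<open>X\<close> the point indicators give independent sets of
  every finite size inside \<open>D\<close>.\<close>

lemma eigen_indices_eq:
  fixes m :: "'a \<Rightarrow> real"
  assumes "D \<subseteq> ell2 m" "fin_supp_funs \<subseteq> D"
  shows "eigen_indices m = {n. 1 \<le> n \<and>
    (\<exists>B. B \<subseteq> D \<and> fun_space.independent B \<and> finite B \<and> card B = n)}"
proof (cases "finite (UNIV :: 'a set)")
  case True
  then have "fin_supp_funs = (UNIV :: ('a \<Rightarrow> real) set)"
    by (auto simp: fin_supp_funs_def intro: finite_subset[of _ UNIV])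
  then have "ell2 m = D" using assms by auto
  then show ?thesis by (simp add: eigen_indices_def)
next
  case False
  have ex: "\<exists>B. B \<subseteq> D \<and> fun_space.independent B \<and> finite B \<and> card B = n" for n
  proof -
    obtain F :: "'a set" where F: "finite F" "card F = n"
      using infinite_arbitrarily_large[OF False] by auto
    have "inj_on (\<lambda>x. indicator {x} :: 'a \<Rightarrow> real) F"
      by (rule inj_onI) (metis indicator_eq_0_iff indicator_eq_1_iff insertI1 singletonD zero_neq_one)
    then show ?thesis
      using F independent_deltas[OF F(1)]
      by (intro exI[of _ "(\<lambda>x. indicator {x}) ` F"])
        (auto simp: card_image intro: subsetD[OF assms(2)] indicator_in_fin_supp_funs)
  qed
  then show ?thesis
    unfolding eigen_indices_def using assms(1) by (metis (no_types, lifting) order_trans)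
qed

lemma greedy_eigenvalues:
  assumes gs: "greedy_sequence fun_scale D (ell2_inner m) Q e"
    and ao: "associated_operator m Q D DL L"
    and D: "D \<subseteq> ell2 m" "fin_supp_funs \<subseteq> D"
    and n: "n \<in> greedy_sequence.alive D (ell2_inner m) e"
  shows "Suc n \<in> eigen_indices m"
    and "nth_eigenvalue m DL L (Suc n) = greedy_sequence.lam Q e n"
proof -
  interpret greedy_sequence fun_scale D "ell2_inner m" Q e by fact
  have idx: "eigen_indices m = Suc ` alive"
  proof (rule set_eqI)
    show "k \<in> eigen_indices m \<longleftrightarrow> k \<in> Suc ` alive" for k
      unfolding eigen_indices_eq[OF D] by (cases k) (auto simp: inj_image_mem_iff alive_iff_independent)
  qed
  show 1: "Suc n \<in> eigen_indices m" using n idx by simp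
  \<comment> \<open>The shift \<open>k - 1\<close> passes from indices starting at 1 to those
    starting at 0.\<close>
  have "eigenvalue_listing m DL L (\<lambda>k. lam (k - 1))"
    unfolding eigenvalue_listing_def
  proof (intro conjI allI)
    show "mono_on (eigen_indices m) (\<lambda>k. lam (k - 1))"
      unfolding idx by (auto simp: monotone_on_def intro: lam_mono)
    fix t
    let ?F = "{k \<in> alive. lam k = t}"
    have F: "{k \<in> eigen_indices m. lam (k - 1) = t} = Suc ` ?F" unfolding idx by auto
    have "bij_betw (e \<circ> (\<lambda>k. k - 1)) (Suc ` ?F) (e ` ?F)"
      by (rule bij_betw_trans[of _ _ ?F])
        (auto simp: bij_betw_def image_image inj_on_def intro: inj_onD[OF inj_on_e])
    moreover have "fun_space.span (e ` ?F) = eigenspace DL L t"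
      using eigenspace_eq_weak_eigenspace[OF ao D(1) form.subspace compact_form_axioms]
        weak_eigenspace_eq_span by simp
    ultimately show "\<exists>B h. fun_space.independent B \<and> fun_space.span B = eigenspace DL L t \<and>
        bij_betw h {k \<in> eigen_indices m. lam (k - 1) = t} B"
      unfolding F using independent_image[of ?F] by blast
  qed
  from nth_eigenvalue_eq[OF this 1] show "nth_eigenvalue m DL L (Suc n) = lam n" by simp
qed


section \<open>Isospectral potentials\<close>

theorem corollary11:
  fixes b :: "'a::countable \<Rightarrow> 'a \<Rightarrow> real"
    and c m :: "'a \<Rightarrow> real"
    and D0 DL0 DLc :: "('a \<Rightarrow> real) set"
    and L0 Lc :: "('a \<Rightarrow> real) \<Rightarrow> 'a \<Rightarrow> real"
  assumes "graph_over b (\<lambda>_. 0) m"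
    and "realization b m D0 DL0 L0"
    and "compactly_embedded m (energy_form b (\<lambda>_. 0)) D0"
    and "\<forall>x. 0 \<le> c x"
    and "induced_realization b c m D0 DLc Lc"
    and "(\<lambda>x. \<bar>c x / m x\<bar>) summable_on UNIV"
    and "\<forall>n\<in>eigen_indices m. nth_eigenvalue m DLc Lc n = nth_eigenvalue m DL0 L0 n"
  shows "c = (\<lambda>_. 0)"
proof -
  let ?ip = "ell2_inner m" and ?Q = "energy_form b (\<lambda>_. 0)" and ?Qc = "energy_form b c"
  have m: "\<And>x. 0 < m x" and c: "\<And>x. 0 \<le> c x"
    using assms(1,4) by (auto simp: graph_over_def)
  have rf: "realization_form b m D0" and ao0: "associated_operator m ?Q D0 DL0 L0"
    using assms(2) by (auto simp: realization_def)
  have D: "D0 \<subseteq> ell2 m" "fin_supp_funs \<subseteq> D0" "fun_space.subspace D0"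
    using rf by (auto simp: realization_form_def)
  \<comment> \<open>A sum of nonnegative terms dominates each of them, so \<open>c\<close> is
    bounded by \<open>K * m\<close>. Hence \<open>ell2 m\<close> lies in the
    \<open>c\<close>-weighted space, the induced domain is \<open>D0\<close> itself, and the
    potential is a bounded perturbation.\<close>
  define K where "K = (\<Sum>\<^sub>\<infinity>x. \<bar>c x / m x\<bar>)"
  have cK: "c x \<le> K * m x" for x
  proof -
    have "(\<Sum>x\<in>{x}. \<bar>c x / m x\<bar>) \<le> K"
      unfolding K_def by (rule finite_sum_le_infsum[OF assms(6)]) auto
    then show ?thesis using m[of x] by (simp add: field_simps)
  qed
  have ell2_c: "ell2 m \<subseteq> sq_summable c"
  proof
    fix f assume "f \<in> ell2 m"
    then have "(\<lambda>x. K * (m x * (f x)\<^sup>2)) summable_on UNIV"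
      by (intro summable_on_cmult_right) (simp add: ell2_eq sq_summable_def)
    then show "f \<in> sq_summable c"
      unfolding sq_summable_def mem_Collect_eq
      by (rule summable_on_comparison_test)
        (use cK c in \<open>auto simp: mult_right_mono simp flip: mult.assoc\<close>)
  qed
  have "induced_domain c m D0 = D0"
    using D(1) ell2_c by (auto simp: induced_domain_def sq_summable_def subset_iff)
  then have aoc: "associated_operator m ?Qc D0 DLc Lc"
    using assms(5) by (simp add: induced_realization_def)
  interpret F0: compact_form fun_scale D0 ?ip ?Q
    by (rule realization_compact_form[OF assms(1) rf assms(3)])
  have psd_c: "psd_form fun_scale D0 (weighted_form c)"
    using psd_form_weighted[of c "\<lambda>f. f" D0] c D ell2_c by auto
  have le_K: "weighted_form c u u \<le> K * ?ip u u" if "u \<in> D0" for u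
  proof -
    have "u \<in> sq_summable m" "u \<in> sq_summable c" using that D(1) ell2_c by (auto simp: ell2_eq)
    then show ?thesis
      unfolding ell2_inner_eq weighted_form_def infsum_cmult_right'[symmetric]
      by (intro infsum_mono summable_on_cmult_right sq_summable_mult)
        (use mult_right_mono[OF cK zero_le_square] c m in \<open>auto simp: less_imp_le mult.assoc\<close>)
  qed
  interpret Fc: compact_form fun_scale D0 ?ip ?Qc
    using F0.compact_form_perturb[OF psd_c le_K] by (simp flip: energy_form_split)
  obtain e where e: "greedy_sequence fun_scale D0 ?ip ?Q e"
    using F0.exists_greedy_sequence by blast
  obtain e' where e': "greedy_sequence fun_scale D0 ?ip ?Qc e'"
    using Fc.exists_greedy_sequence by blast
  interpret A: greedy_sequence fun_scale D0 ?ip ?Q e by fact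
  interpret B: greedy_sequence fun_scale D0 ?ip ?Qc e' by fact
  have alive: "B.alive = A.alive"
    by (rule set_eqI) (simp only: A.alive_iff_independent B.alive_iff_independent)
  have lam: "B.lam n = A.lam n" if "n \<in> A.alive" for n
    using greedy_eigenvalues[OF e ao0 D(1,2) that] greedy_eigenvalues(2)[OF e' aoc D(1,2)] that alive
      assms(7) by auto
  \<comment> \<open>The forms differ exactly by \<open>weighted_form c\<close>, which therefore
    vanishes on the eigenvectors of the unperturbed form.\<close>
  have zero: "weighted_form c (e n) (e n) = 0" if "n \<in> A.alive" for n
    using isospectral_forms_agree[OF e e' _ lam that]
    by (simp add: energy_form_split[of b c] weighted_form_nonneg c)
  show ?thesis
  proof
    fix x
    have delta: "indicator {x} \<in> D0" by (rule subsetD[OF D(2) indicator_in_fin_supp_funs])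
    \<comment> \<open>If every \<open>e n\<close> vanished at \<open>x\<close>, the indicator of
      \<open>x\<close> would be orthogonal to all of them and hence zero by completeness.\<close>
    have "\<exists>n\<in>A.alive. e n x \<noteq> 0"
    proof (rule ccontr)
      assume neg: "\<not> ?thesis"
      have "ell2_inner m (indicator {x}) (e n) = 0" if "n \<in> A.alive" for n
        unfolding ell2_inner_def using neg that
        by (intro infsum_0) (auto simp: indicator_def)
      then have "(indicator {x} :: 'a \<Rightarrow> real) = 0" by (rule A.e_complete[OF delta])
      then have "(indicator {x} x :: real) = 0" by (simp only: zero_fun_apply)
      then show False by simp
    qed
    then obtain n where n: "n \<in> A.alive" "e n x \<noteq> 0" by blast
    \<comment> \<open>The term at \<open>x\<close> is bounded by a sum of nonnegative terms that
      equals zero.\<close>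
    have "(\<Sum>x\<in>{x}. c x * e n x * e n x) \<le> weighted_form c (e n) (e n)"
      unfolding weighted_form_def using A.e_in_D[OF n(1)] D(1) ell2_c c
      by (intro finite_sum_le_infsum sq_summable_mult) (auto simp: mult.assoc)
    then have "c x * (e n x * e n x) \<le> 0" using zero[OF n(1)] by (simp add: mult.assoc)
    then have "c x \<le> 0"
      using n(2) by (auto simp: mult_le_0_iff)
    then show "c x = 0" using c[of x] by simp
  qed
qed

end
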